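(* Let $Q$ be a Noetherian commutative monoid. For a $Q$-module $T$, the following are equivalent. (1) $T$ is mesoprimary. (2) $T$ has exactly one associated prime congruence. (3) $T$ is $P$-primary for some prime ideal $P\subset Q$, and for $F=Q\setminus P$, $$\ker(F\to\langle t\rangle)=\ker(F\to\langle t'\rangle)$$ for each non-nil $t,t'\in T$. Here $F\to\langle t\rangle$ is the map $f\mapsto f\cdot t$, and its kernel is the equivalence relation on $F$ identifying $f,g$ whenever $f\cdot t=g\cdot t$.
   Context: $Q$ is a commutative monoid, written additively with identity $0$; Noetherian means equivalently that $Q$ is finitely generated. A $Q$-module is a set $T$ with a left action of $Q$ such that $0\cdot t=t$ and $(q+q')\cdot t=q\cdot(q'\cdot t)$. For $t\in T$, $\langle t\rangle=Q\cdot t$. An element $\infty\in T$ is nil if $Q\cdot\infty=\{\infty\}$; $N(T)$ is the set of nil elements. For $q\in Q$ let $\phi_q:T\to T$, $t\mapsto q\cdot t$. An element $q\in Q$ acts cancellatively on $T$ if $\phi_q$ is injective, and acts nilpotently on $T$ if for each $t\in T$ there is a nonnegative integer $n$ with $(nq)\cdot t\in N(T)$. An element $t\in T$ is partly cancellative if whenever $a\cdot t=b\cdot t\notin N(T)$ for $a,b\in Q$ that act cancellatively on $T$, the maps $\phi_a$ and $\phi_b$ coincide. $T$ is primary if each $q\in Q$ acts either cancellatively or nilpotently on $T$, and mesoprimary if it is primary and each $t\in T$ is partly cancellative. For a prime ideal $P\subset Q$, $T$ is $P$-primary if each $p\in P$ acts nilpotently and each $f\in Q\setminus P$ acts cancellatively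 on $T$. An ideal of $Q$ is a (possibly empty) subset $I$ with $Q+I\subset I$; an ideal $P$ is prime if $Q\setminus P$ is a submonoid of $Q$. For $P$ prime with $F=Q\setminus P$, the localization $T_P$ is $T\times F$ modulo $(t,f)\sim(t',f')$ iff $w\cdot f'\cdot t=w\cdot f\cdot t'$ for some $w\in F$; $Q_P$ is a monoid, $T_P$ is a $Q_P$-module, and $P_P\subset Q_P$ is the ideal generated by the image of $P$. For $t\in T$, $\bar t$ denotes its image in $T_P$. Green's preorder on a module sets $t\preceq t'$ whenever $\langle t\rangle\supset\langle t'\rangle$. The kernel $\ker\phi$ of a map $\phi$ is the equivalence relation identifying elements with equal image. For $p\in P$ let $\phi_p:T_P\to T_P$ be the action of $p$. An element $w\in T$ is exclusively maximal in a set $A\subset T_P$ if $\bar w$ is the unique maximal element of $A$ under Green's preorder. An element $w\in T$ with non-nil image in $T_P$ is a key witness for $P$ if the class of $\bar w$ under $\bigcap_{p\in P}\ker(\phi_p)$ is not a singleton and $\bar w$ is not exclusively maximal in this class. Let $G_P$ be the unit group of $Q_P$ and, for non-nil $w\in T$, let $K_w^P\subset G_P$ be the stabilizer of $\bar w\in T_P$ under the action of $G_P$. Let $\approx$ be the congruence on $Q_P$ that sets $a\approx b$ whenever either $a,b\in P_P$, or $a,b\in G_P$ and $a-b\in K_w^P$. The $P$-prime congruence of $T$ at $w$ is the congruence $\ker(Q\to Q_P/{\approx})$ on $Q$. The $P$-prime congruence of $T$ at $w$ is associated to $T$ if $w$ is a key witness of $T$ for $P$.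
   Formalization: The implication from (1) to (2) is stated only for T having a non-nil element: if all elements of T are nil (e.g. T is empty or a single nil), (1) and (3) hold but T has no key witness, hence no associated prime congruence, so (2) fails. *)

theory Defs
  imports "HOL-Algebra.Group_Action" "HOL.Hull"
begin

text \<open>
  Monoids are the (multiplicatively written) commutative monoids of HOL-Algebra: a sum
  of monoid elements becomes a product, the identity \<open>0\<close> becomes \<open>\<one>\<close>, a multiple \<open>n q\<close> becomes
  a power, and \<open>\<phi> q t\<close> stands for \<open>q \<cdot> t\<close>.  A module is a triple \<open>Q \<phi> T\<close>; the carrier \<open>T\<close> is a
  set and may be empty.
\<close>

text \<open>
  Noetherian commutative monoids are the finitely generated ones.
\<close>

definition noetherian_monoid :: "('a, 'm) monoid_scheme \<Rightarrow> bool" where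
  "noetherian_monoid Q \<longleftrightarrow> comm_monoid Q \<and>
     (\<exists>S. finite S \<and> S \<subseteq> carrier Q \<and> (\<lambda>H. submonoid H Q) hull S = carrier Q)"

locale monoid_module = comm_monoid Q
  for Q (structure) and \<phi> :: "'a \<Rightarrow> 't \<Rightarrow> 't" and T :: "'t set" +
  assumes act_closed: "\<lbrakk>q \<in> carrier Q; t \<in> T\<rbrakk> \<Longrightarrow> \<phi> q t \<in> T"
    and act_one: "t \<in> T \<Longrightarrow> \<phi> \<one> t = t"
    and act_mult: "\<lbrakk>q \<in> carrier Q; q' \<in> carrier Q; t \<in> T\<rbrakk> \<Longrightarrow> \<phi> (q \<otimes> q') t = \<phi> q (\<phi> q' t)"

text \<open>
  The cyclic submodule \<open>\<langle>t\<rangle>\<close> is \<^term>\<open>orbit Q \<phi> t\<close>.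
\<close>

definition nil_elements :: "('a, 'm) monoid_scheme \<Rightarrow> ('a \<Rightarrow> 't \<Rightarrow> 't) \<Rightarrow> 't set \<Rightarrow> 't set" where
  "nil_elements Q \<phi> T = {x \<in> T. orbit Q \<phi> x = {x}}"

definition green_le :: "('a, 'm) monoid_scheme \<Rightarrow> ('a \<Rightarrow> 't \<Rightarrow> 't) \<Rightarrow> 't \<Rightarrow> 't \<Rightarrow> bool" where
  "green_le Q \<phi> t t' \<longleftrightarrow> orbit Q \<phi> t' \<subseteq> orbit Q \<phi> t"

definition ker_on :: "'x set \<Rightarrow> ('x \<Rightarrow> 'y) \<Rightarrow> 'x rel" where
  "ker_on A f = {(x, y). x \<in> A \<and> y \<in> A \<and> f x = f y}"


section \<open>Primary and mesoprimary modules\<close>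

definition acts_cancellatively :: "('a \<Rightarrow> 't \<Rightarrow> 't) \<Rightarrow> 't set \<Rightarrow> 'a \<Rightarrow> bool" where
  "acts_cancellatively \<phi> T q \<longleftrightarrow> inj_on (\<phi> q) T"

definition acts_nilpotently ::
    "('a, 'm) monoid_scheme \<Rightarrow> ('a \<Rightarrow> 't \<Rightarrow> 't) \<Rightarrow> 't set \<Rightarrow> 'a \<Rightarrow> bool" where
  "acts_nilpotently Q \<phi> T q \<longleftrightarrow>
     (\<forall>t\<in>T. \<exists>n::nat. \<phi> (q [^]\<^bsub>Q\<^esub> n) t \<in> nil_elements Q \<phi> T)"

definition partly_cancellative ::
    "('a, 'm) monoid_scheme \<Rightarrow> ('a \<Rightarrow> 't \<Rightarrow> 't) \<Rightarrow> 't set \<Rightarrow> 't \<Rightarrow> bool" where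
  "partly_cancellative Q \<phi> T t \<longleftrightarrow>
     (\<forall>a\<in>carrier Q. \<forall>b\<in>carrier Q.
        acts_cancellatively \<phi> T a \<and> acts_cancellatively \<phi> T b \<and>
        \<phi> a t = \<phi> b t \<and> \<phi> a t \<notin> nil_elements Q \<phi> T
        \<longrightarrow> (\<forall>s\<in>T. \<phi> a s = \<phi> b s))"

definition primary_module ::
    "('a, 'm) monoid_scheme \<Rightarrow> ('a \<Rightarrow> 't \<Rightarrow> 't) \<Rightarrow> 't set \<Rightarrow> bool" where
  "primary_module Q \<phi> T \<longleftrightarrow>
     (\<forall>q\<in>carrier Q. acts_cancellatively \<phi> T q \<or> acts_nilpotently Q \<phi> T q)"

definition mesoprimary_module ::
    "('a, 'm) monoid_scheme \<Rightarrow> ('a \<Rightarrow> 't \<Rightarrow> 't) \<Rightarrow> 't set \<Rightarrow> bool" where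
  "mesoprimary_module Q \<phi> T \<longleftrightarrow>
     primary_module Q \<phi> T \<and> (\<forall>t\<in>T. partly_cancellative Q \<phi> T t)"

definition monoid_ideal :: "('a, 'm) monoid_scheme \<Rightarrow> 'a set \<Rightarrow> bool" where
  "monoid_ideal Q I \<longleftrightarrow> I \<subseteq> carrier Q \<and> (\<forall>q\<in>carrier Q. \<forall>i\<in>I. q \<otimes>\<^bsub>Q\<^esub> i \<in> I)"

definition prime_monoid_ideal :: "('a, 'm) monoid_scheme \<Rightarrow> 'a set \<Rightarrow> bool" where
  "prime_monoid_ideal Q P \<longleftrightarrow> monoid_ideal Q P \<and> submonoid (carrier Q - P) Q"

text \<open>
  The empty set is a prime ideal, whereas the whole monoid is not, since its complement
  does not contain the identity.
\<close>

definition P_primary_module ::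
    "('a, 'm) monoid_scheme \<Rightarrow> ('a \<Rightarrow> 't \<Rightarrow> 't) \<Rightarrow> 't set \<Rightarrow> 'a set \<Rightarrow> bool" where
  "P_primary_module Q \<phi> T P \<longleftrightarrow>
     (\<forall>p\<in>P. acts_nilpotently Q \<phi> T p) \<and> (\<forall>f\<in>carrier Q - P. acts_cancellatively \<phi> T f)"


section \<open>Localization at a prime ideal\<close>

definition loc_rel ::
    "('a, 'm) monoid_scheme \<Rightarrow> ('a \<Rightarrow> 't \<Rightarrow> 't) \<Rightarrow> 't set \<Rightarrow> 'a set \<Rightarrow> ('t \<times> 'a) rel" where
  "loc_rel Q \<phi> T P =
     {((t, f), (t', f')). t \<in> T \<and> t' \<in> T \<and> f \<in> carrier Q - P \<and> f' \<in> carrier Q - P \<and>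
        (\<exists>w\<in>carrier Q - P. \<phi> w (\<phi> f' t) = \<phi> w (\<phi> f t'))}"

text \<open>The class of \<open>(t, f)\<close>, that is, the fraction with numerator \<open>t\<close> and denominator \<open>f\<close>.\<close>

definition loc_frac ::
    "('a, 'm) monoid_scheme \<Rightarrow> ('a \<Rightarrow> 't \<Rightarrow> 't) \<Rightarrow> 't set \<Rightarrow> 'a set \<Rightarrow> 't \<Rightarrow> 'a \<Rightarrow> ('t \<times> 'a) set" where
  "loc_frac Q \<phi> T P t f = loc_rel Q \<phi> T P `` {(t, f)}"

definition loc_module ::
    "('a, 'm) monoid_scheme \<Rightarrow> ('a \<Rightarrow> 't \<Rightarrow> 't) \<Rightarrow> 't set \<Rightarrow> 'a set \<Rightarrow> ('t \<times> 'a) set set" where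
  "loc_module Q \<phi> T P = (T \<times> (carrier Q - P)) // loc_rel Q \<phi> T P"

abbreviation loc_map ::
    "('a, 'm) monoid_scheme \<Rightarrow> ('a \<Rightarrow> 't \<Rightarrow> 't) \<Rightarrow> 't set \<Rightarrow> 'a set \<Rightarrow> 't \<Rightarrow> ('t \<times> 'a) set" where
  "loc_map Q \<phi> T P t \<equiv> loc_frac Q \<phi> T P t \<one>\<^bsub>Q\<^esub>"

text \<open>
  The action of \<open>Q\<^sub>P\<close> on \<open>T\<^sub>P\<close>: the class of \<open>(q, f)\<close> sends the class of \<open>(t, g)\<close> to the class of
  \<open>(q \<cdot> t, f \<otimes> g)\<close>.  The union runs over all representatives, whose products
  all lie in one and the same class.
\<close>

definition loc_act ::
    "('a, 'm) monoid_scheme \<Rightarrow> ('a \<Rightarrow> 't \<Rightarrow> 't) \<Rightarrow> 't set \<Rightarrow> 'a set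
      \<Rightarrow> ('a \<times> 'a) set \<Rightarrow> ('t \<times> 'a) set \<Rightarrow> ('t \<times> 'a) set" where
  "loc_act Q \<phi> T P a x = (\<Union>(q, f)\<in>a. \<Union>(t, g)\<in>x. loc_frac Q \<phi> T P (\<phi> q t) (f \<otimes>\<^bsub>Q\<^esub> g))"

text \<open>The monoid \<open>Q\<^sub>P\<close> is the localization of \<open>Q\<close> as a module over itself.\<close>

definition loc_monoid :: "('a, 'm) monoid_scheme \<Rightarrow> 'a set \<Rightarrow> ('a \<times> 'a) set monoid" where
  "loc_monoid Q P =
     \<lparr>carrier = loc_module Q (mult Q) (carrier Q) P,
      monoid.mult = loc_act Q (mult Q) (carrier Q) P,
      one = loc_map Q (mult Q) (carrier Q) P \<one>\<^bsub>Q\<^esub>\<rparr>"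

abbreviation loc_monoid_map :: "('a, 'm) monoid_scheme \<Rightarrow> 'a set \<Rightarrow> 'a \<Rightarrow> ('a \<times> 'a) set" where
  "loc_monoid_map Q P q \<equiv> loc_map Q (mult Q) (carrier Q) P q"

definition loc_ideal :: "('a, 'm) monoid_scheme \<Rightarrow> 'a set \<Rightarrow> ('a \<times> 'a) set set" where
  "loc_ideal Q P = monoid_ideal (loc_monoid Q P) hull (loc_monoid_map Q P ` P)"

definition loc_nil ::
    "('a, 'm) monoid_scheme \<Rightarrow> ('a \<Rightarrow> 't \<Rightarrow> 't) \<Rightarrow> 't set \<Rightarrow> 'a set \<Rightarrow> ('t \<times> 'a) set set" where
  "loc_nil Q \<phi> T P = nil_elements (loc_monoid Q P) (loc_act Q \<phi> T P) (loc_module Q \<phi> T P)"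


section \<open>Key witnesses\<close>

text \<open>
  The relation \<open>\<Inter>\<^sub>p ker \<phi>\<^sub>p\<close> (\<open>p \<in> P\<close>) on \<open>T\<^sub>P\<close>; for \<open>P = \<emptyset>\<close> the empty intersection
  is the full relation on \<open>T\<^sub>P\<close>.
\<close>

definition common_ker ::
    "('a, 'm) monoid_scheme \<Rightarrow> ('a \<Rightarrow> 't \<Rightarrow> 't) \<Rightarrow> 't set \<Rightarrow> 'a set \<Rightarrow> ('t \<times> 'a) set rel" where
  "common_ker Q \<phi> T P = (loc_module Q \<phi> T P \<times> loc_module Q \<phi> T P) \<inter>
     (\<Inter>p\<in>P. ker_on (loc_module Q \<phi> T P) (loc_act Q \<phi> T P (loc_monoid_map Q P p)))"

text \<open>
  Maximality is with respect to a preorder: nothing lies strictly above.  Uniqueness is literal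
  equality of elements, not equivalence under the preorder.
\<close>

definition green_maximals ::
    "('a, 'm) monoid_scheme \<Rightarrow> ('a \<Rightarrow> 't \<Rightarrow> 't) \<Rightarrow> 't set \<Rightarrow> 't set" where
  "green_maximals Q \<phi> A = {x \<in> A. \<forall>y\<in>A. green_le Q \<phi> x y \<longrightarrow> green_le Q \<phi> y x}"

definition exclusively_maximal ::
    "('a, 'm) monoid_scheme \<Rightarrow> ('a \<Rightarrow> 't \<Rightarrow> 't) \<Rightarrow> 't set \<Rightarrow> 'a set \<Rightarrow> 't \<Rightarrow> ('t \<times> 'a) set set \<Rightarrow> bool"
  where
  "exclusively_maximal Q \<phi> T P w A \<longleftrightarrow>
     green_maximals (loc_monoid Q P) (loc_act Q \<phi> T P) A = {loc_map Q \<phi> T P w}"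

definition key_witness ::
    "('a, 'm) monoid_scheme \<Rightarrow> ('a \<Rightarrow> 't \<Rightarrow> 't) \<Rightarrow> 't set \<Rightarrow> 'a set \<Rightarrow> 't \<Rightarrow> bool" where
  "key_witness Q \<phi> T P w \<longleftrightarrow>
     w \<in> T \<and> loc_map Q \<phi> T P w \<notin> loc_nil Q \<phi> T P \<and>
     (let C = common_ker Q \<phi> T P `` {loc_map Q \<phi> T P w}
      in \<not> is_singleton C \<and> \<not> exclusively_maximal Q \<phi> T P w C)"


section \<open>Associated prime congruences\<close>

definition loc_stabilizer ::
    "('a, 'm) monoid_scheme \<Rightarrow> ('a \<Rightarrow> 't \<Rightarrow> 't) \<Rightarrow> 't set \<Rightarrow> 'a set \<Rightarrow> 't \<Rightarrow> ('a \<times> 'a) set set" where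
  "loc_stabilizer Q \<phi> T P w =
     stabilizer (units_of (loc_monoid Q P)) (loc_act Q \<phi> T P) (loc_map Q \<phi> T P w)"

definition loc_congruence ::
    "('a, 'm) monoid_scheme \<Rightarrow> ('a \<Rightarrow> 't \<Rightarrow> 't) \<Rightarrow> 't set \<Rightarrow> 'a set \<Rightarrow> 't \<Rightarrow> ('a \<times> 'a) set rel" where
  "loc_congruence Q \<phi> T P w =
     {(a, b). (a \<in> loc_ideal Q P \<and> b \<in> loc_ideal Q P) \<or>
        (a \<in> Units (loc_monoid Q P) \<and> b \<in> Units (loc_monoid Q P) \<and>
         a \<otimes>\<^bsub>loc_monoid Q P\<^esub> inv\<^bsub>loc_monoid Q P\<^esub> b \<in> loc_stabilizer Q \<phi> T P w)}"

definition prime_congruence ::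
    "('a, 'm) monoid_scheme \<Rightarrow> ('a \<Rightarrow> 't \<Rightarrow> 't) \<Rightarrow> 't set \<Rightarrow> 'a set \<Rightarrow> 't \<Rightarrow> 'a rel" where
  "prime_congruence Q \<phi> T P w =
     ker_on (carrier Q) (\<lambda>q. loc_congruence Q \<phi> T P w `` {loc_monoid_map Q P q})"

definition associated_prime_congruences ::
    "('a, 'm) monoid_scheme \<Rightarrow> ('a \<Rightarrow> 't \<Rightarrow> 't) \<Rightarrow> 't set \<Rightarrow> 'a rel set" where
  "associated_prime_congruences Q \<phi> T =
     {prime_congruence Q \<phi> T P w | P w. prime_monoid_ideal Q P \<and> key_witness Q \<phi> T P w}"

end

theory Submission
  imports Defs "HOL.Topological_Spaces" "HOL-Algebra.FiniteProduct" "HOL-Library.Infinite_Set"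
begin

text \<open>
  Everything rests on one way of producing key witnesses, \<open>separated_pair_has_key_witness\<close>.
  Let \<open>M\<close> be a submonoid no element of which identifies \<open>a\<close> and \<open>b\<close>, and for \<open>c\<close> in \<open>Q\<close> let
  \<open>I c\<close> be the ideal of those \<open>r\<close> for which some \<open>u\<close> in \<open>M\<close> satisfies \<open>urca = urcb\<close>.  Since \<open>Q\<close> is
  finitely generated, some \<open>I c\<close> is maximal among the proper ideals of this form, and it is then
  a prime \<open>P\<close> disjoint from \<open>M\<close>.  The images of \<open>ca\<close> and \<open>cb\<close> in \<open>T\<^sub>P\<close> differ but are identified by
  every element of \<open>P\<close>.  So they share a class with at least two elements.  They cannot both be
  the only maximal element of that class, and a nil element is always maximal in a class that
  contains it; hence one of the two is a key witness unless both are nil in \<open>T\<^sub>P\<close>.  A relation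
  \<open>qa = q'b\<close> excludes this last case, because nil elements are fixed by \<open>q\<close> and by \<open>q'\<close>.

  On the complement \<open>F\<close> of \<open>P\<close>, the prime congruence at \<open>w\<close> relates \<open>f\<close> and \<open>g\<close> exactly if \<open>fw\<close> and
  \<open>gw\<close> agree in \<open>T\<^sub>P\<close>, and the congruence determines \<open>P\<close>.  Suppose that there is only one associated
  prime congruence, hence only one prime \<open>P\<close> with key witnesses.  If \<open>f\<close> identifies \<open>a \<noteq> b\<close>, then the
  pair \<open>(a, b)\<close> gives a key witness for a prime that contains \<open>f\<close>; if \<open>p\<close> is not nilpotent at \<open>t\<close>,
  then \<open>M = {p\<^sup>n}\<close> and a pair \<open>(t, st)\<close> give one for a prime that does not contain \<open>p\<close>.  So \<open>T\<close> is
  \<open>P\<close>-primary.  For the kernels, each non-nil \<open>t\<close> has a multiple that is a key witness (use a pair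
  \<open>(t, qt)\<close>), so \<open>ft = gt\<close> forces \<open>f\<close> and \<open>g\<close> to be congruent.  If conversely \<open>f\<close> and \<open>g\<close> are congruent
  but \<open>ft \<noteq> gt\<close>, then the pair \<open>(ft, gt)\<close>, which satisfies \<open>g(ft) = f(gt)\<close>, gives a key witness on
  which \<open>f\<close> and \<open>g\<close> agree, and cancelling \<open>f\<close> or \<open>g\<close> is a contradiction.

  In the other direction, the nilpotently acting elements of a mesoprimary module form a prime \<open>P\<close>
  (unless all elements are nil).  A prime with a key witness contains every element acting
  nilpotently and none acting cancellatively, so it is \<open>P\<close>; and since \<open>ft = gt\<close> depends
  only on \<open>f\<close> and \<open>g\<close> in \<open>F\<close>, not on the non-nil \<open>t\<close>, all key witnesses have the same congruence.
\<close>
section \<open>Ideals of a finitely generated commutative monoid\<close>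

text \<open>
  A sequence with infinitely many bounded terms takes its least such bound infinitely often and
  so has a constant subsequence; any other sequence tends to infinity, and then its monotone
  subsequence cannot be decreasing.
\<close>
lemma nat_sequence_has_incseq_subsequence:
  fixes x :: "nat \<Rightarrow> nat"
  shows "\<exists>r :: nat \<Rightarrow> nat. strict_mono r \<and> incseq (\<lambda>n. x (r n))"
proof (cases "\<exists>B. \<forall>N. \<exists>n\<ge>N. x n \<le> B")
  case True
  define B where "B = (LEAST B. \<forall>N. \<exists>n\<ge>N. x n \<le> B)"
  have B: "\<forall>N. \<exists>n\<ge>N. x n \<le> B"
    unfolding B_def using True by (rule LeastI_ex)
  have "infinite {n. x n = B}"
  proof (cases B)
    case 0
    then show ?thesis using B by (auto simp: infinite_nat_iff_unbounded_le)
  next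
    case (Suc b)
    then have "\<not> (\<forall>N. \<exists>n\<ge>N. x n \<le> b)"
      unfolding B_def using not_less_Least[of b "\<lambda>B. \<forall>N. \<exists>n\<ge>N. x n \<le> B"] by auto
    then obtain N where N: "\<And>n. n \<ge> N \<Longrightarrow> x n > b" by force
    have "\<exists>n\<ge>m. x n = B" for m
    proof -
      obtain n where "n \<ge> max m N" "x n \<le> B" using B by blast
      then show ?thesis using N[of n] Suc by (intro exI[of _ n]) auto
    qed
    then show ?thesis by (auto simp: infinite_nat_iff_unbounded_le)
  qed
  then obtain r :: "nat \<Rightarrow> nat" where r: "strict_mono r" "\<And>n. r n \<in> {n. x n = B}"
    using infinite_enumerate[of "{n. x n = B}"] by metis
  have "x (r n) = B" for n using r(2)[of n] by simp
  then show ?thesis using r(1) by (intro exI[of _ r] conjI) (simp_all add: incseq_def)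
next
  case False
  then have grow: "\<exists>N. \<forall>n\<ge>N. x n > B" for B by (meson not_le)
  obtain r where r: "strict_mono r" "monoseq (\<lambda>n. x (r n))"
    using seq_monosub[of x] by auto
  from r(2) consider "incseq (\<lambda>n. x (r n))" | "decseq (\<lambda>n. x (r n))"
    by (auto simp: monoseq_iff)
  then show ?thesis
  proof cases
    case 1
    with r(1) show ?thesis by blast
  next
    case 2
    obtain N where N: "\<And>n. n \<ge> N \<Longrightarrow> x n > x (r 0)" using grow by blast
    have "x (r N) \<le> x (r 0)" using 2 by (auto simp: decseq_def)
    moreover have "N \<le> r N" using r(1) by (rule strict_mono_imp_increasing)
    ultimately show ?thesis using N[of "r N"] by simp
  qed
qed

text \<open>
  Dickson's lemma, in the form that passes to a subsequence increasing in all coordinates at once,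
  which is what makes the induction on the number of coordinates work.
\<close>
lemma dickson:
  fixes x :: "nat \<Rightarrow> 's \<Rightarrow> nat"
  assumes "finite S"
  shows "\<exists>r :: nat \<Rightarrow> nat. strict_mono r \<and> (\<forall>s\<in>S. incseq (\<lambda>n. x (r n) s))"
  using assms
proof (induction S)
  case empty
  show ?case by (rule exI[of _ id]) (simp add: strict_mono_def)
next
  case (insert s S)
  then obtain r where r: "strict_mono r" "\<forall>s\<in>S. incseq (\<lambda>n. x (r n) s)" by blast
  obtain r' where r': "strict_mono r'" "incseq (\<lambda>n. x (r (r' n)) s)"
    using nat_sequence_has_incseq_subsequence[of "\<lambda>n. x (r n) s"] by blast
  have "strict_mono (r \<circ> r')" using r(1) r'(1) by (rule strict_mono_o)
  moreover have "incseq (\<lambda>n. x ((r \<circ> r') n) s')" if "s' \<in> S" for s'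
    using r(2) that r'(1) by (auto simp: incseq_def strict_mono_less_eq)
  ultimately show ?case using r'(2) by (intro exI[of _ "r \<circ> r'"]) (auto simp: o_def)
qed

lemma (in comm_monoid) generated_elements_are_monomials:
  assumes S: "finite S" "S \<subseteq> carrier G"
    and gen: "(\<lambda>H. submonoid H G) hull S = carrier G" and q: "q \<in> carrier G"
  shows "\<exists>e :: 'a \<Rightarrow> nat. q = finprod G (\<lambda>s. s [^] e s) S"
proof -
  let ?m = "\<lambda>e :: 'a \<Rightarrow> nat. finprod G (\<lambda>s. s [^] e s) S"
  have "submonoid (range ?m) G"
  proof
    show "range ?m \<subseteq> carrier G"
      using S by (auto intro!: finprod_closed)
    show "\<one> \<in> range ?m"
      using S by (intro image_eqI[of _ _ "\<lambda>_. 0"]) auto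
  next
    fix x y assume "x \<in> range ?m" "y \<in> range ?m"
    then obtain d e where "x = ?m d" "y = ?m e" by blast
    moreover have "?m (\<lambda>s. d s + e s) = finprod G (\<lambda>s. s [^] d s \<otimes> s [^] e s) S"
      using S(2) by (intro finprod_cong') (auto simp: nat_pow_mult)
    moreover have "\<dots> = ?m d \<otimes> ?m e"
      using S by (intro finprod_multf) auto
    ultimately have "x \<otimes> y = ?m (\<lambda>s. d s + e s)" by simp
    then show "x \<otimes> y \<in> range ?m" by (rule range_eqI[where f = ?m])
  qed
  moreover have "S \<subseteq> range ?m"
  proof
    fix s assume s: "s \<in> S"
    have "?m (\<lambda>s'. if s = s' then 1 else 0) = finprod G (\<lambda>s'. if s = s' then s' else \<one>) S"
      using S(2) by (intro finprod_cong') auto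
    also have "\<dots> = s"
      using finprod_singleton[OF s, of "\<lambda>s. s"] S by auto
    finally show "s \<in> range ?m" by (intro range_eqI[OF sym])
  qed
  ultimately have "(\<lambda>H. submonoid H G) hull S \<subseteq> range ?m" by (intro hull_minimal)
  then show ?thesis using gen q by auto
qed

text \<open>
  Elements are monomials in the generators, and one monomial divides another as soon as its
  exponents are smaller.
\<close>
lemma noetherian_sequence_divides:
  fixes Q (structure)
  assumes "noetherian_monoid Q" and x: "\<And>n::nat. x n \<in> carrier Q"
  shows "\<exists>i j. i < j \<and> (\<exists>c\<in>carrier Q. x j = c \<otimes> x i)"
proof -
  interpret comm_monoid Q using assms by (simp add: noetherian_monoid_def)
  obtain S where S: "finite S" "S \<subseteq> carrier Q" "(\<lambda>H. submonoid H Q) hull S = carrier Q"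
    using assms by (auto simp: noetherian_monoid_def)
  have "\<forall>n. \<exists>d :: 'a \<Rightarrow> nat. x n = finprod Q (\<lambda>s. s [^] d s) S"
    using generated_elements_are_monomials[OF S x] by blast
  from choice[OF this] obtain e :: "nat \<Rightarrow> 'a \<Rightarrow> nat"
    where e: "\<And>n. x n = finprod Q (\<lambda>s. s [^] e n s) S" by blast
  obtain r where r: "strict_mono r" "\<forall>s\<in>S. incseq (\<lambda>n. e (r n) s)"
    using dickson[OF S(1)] by blast
  let ?c = "finprod Q (\<lambda>s. s [^] (e (r 1) s - e (r 0) s)) S"
  have le: "e (r 0) s \<le> e (r 1) s" if "s \<in> S" for s
    using r(2) that by (auto simp: incseq_def)
  have "?c \<otimes> x (r 0)
      = finprod Q (\<lambda>s. s [^] (e (r 1) s - e (r 0) s) \<otimes> s [^] e (r 0) s) S"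
    unfolding e using S by (intro finprod_multf[symmetric]) auto
  also have "\<dots> = x (r 1)"
    unfolding e using S(2) le by (intro finprod_cong') (auto simp: nat_pow_mult)
  finally have "x (r 1) = ?c \<otimes> x (r 0)" ..
  moreover have "r 0 < r 1" using r(1) by (simp add: strict_mono_def)
  moreover have "?c \<in> carrier Q" using S by (auto intro!: finprod_closed)
  ultimately show ?thesis by blast
qed

text \<open>
  A strictly ascending chain of ideals would give a sequence with one new element at each step;
  by \<open>noetherian_sequence_divides\<close> a later one would be a multiple of an earlier one, hence not new.
\<close>
lemma noetherian_maximal_ideal_exists:
  assumes noeth: "noetherian_monoid Q"
    and ideals: "\<And>I. I \<in> A \<Longrightarrow> monoid_ideal Q I" and "A \<noteq> {}"
  obtains I where "I \<in> A" "\<And>J. J \<in> A \<Longrightarrow> I \<subseteq> J \<Longrightarrow> J = I"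
proof -
  have "wf {(J, I). J \<in> A \<and> I \<in> A \<and> I \<subset> J}"
    unfolding wf_iff_no_infinite_down_chain
  proof
    assume "\<exists>f. \<forall>i. (f (Suc i), f i) \<in> {(J, I). J \<in> A \<and> I \<in> A \<and> I \<subset> J}"
    then obtain f where f: "\<And>i::nat. f (Suc i) \<in> A" "\<And>i. f i \<subset> f (Suc i)" by blast
    then have "\<forall>i. \<exists>x. x \<in> f (Suc i) \<and> x \<notin> f i" by blast
    then obtain x where x: "\<And>i. x i \<in> f (Suc i)" "\<And>i. x i \<notin> f i" by metis
    have "x i \<in> carrier Q" for i
      using x(1) f(1) ideals unfolding monoid_ideal_def by blast
    then obtain i j c where ij: "i < j" "c \<in> carrier Q" "x j = c \<otimes>\<^bsub>Q\<^esub> x i"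
      using noetherian_sequence_divides[OF noeth, of x] by blast
    have "f (Suc i) \<subseteq> f j"
      using ij(1) f(2) by (intro lift_Suc_mono_le[of f "Suc i" j]) auto
    then have "x i \<in> f j" using x(1) by blast
    moreover have "monoid_ideal Q (f j)" using f(1)[of "j - 1"] ij(1) ideals by auto
    ultimately have "x j \<in> f j" using ij unfolding monoid_ideal_def by auto
    then show False using x(2) by blast
  qed
  moreover obtain I0 where "I0 \<in> A" using \<open>A \<noteq> {}\<close> by blast
  ultimately obtain I where "I \<in> A" "\<And>J. (J, I) \<in> {(J, I). J \<in> A \<and> I \<in> A \<and> I \<subset> J} \<Longrightarrow> J \<notin> A"
    by (rule wfE_min) blast
  then show ?thesis using that by blast
qed

section \<open>Localization of modules\<close>

lemma (in monoid_module) act_commute: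
  assumes "q \<in> carrier Q" "q' \<in> carrier Q" "t \<in> T"
  shows "\<phi> q (\<phi> q' t) = \<phi> q' (\<phi> q t)"
  using assms by (metis act_mult m_comm)

lemma (in monoid_module) nil_iff:
  "x \<in> nil_elements Q \<phi> T \<longleftrightarrow> x \<in> T \<and> (\<forall>q\<in>carrier Q. \<phi> q x = x)"
proof
  assume "x \<in> nil_elements Q \<phi> T"
  then show "x \<in> T \<and> (\<forall>q\<in>carrier Q. \<phi> q x = x)"
    by (auto simp: nil_elements_def orbit_def)
next
  assume x: "x \<in> T \<and> (\<forall>q\<in>carrier Q. \<phi> q x = x)"
  then have "\<exists>q. x = \<phi> q x \<and> q \<in> carrier Q" by (intro exI[of _ \<one>]) simp
  then show "x \<in> nil_elements Q \<phi> T"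
    using x by (auto simp: nil_elements_def orbit_def)
qed

locale localization = monoid_module Q \<phi> T
  for Q (structure) and \<phi> :: "'a \<Rightarrow> 't \<Rightarrow> 't" and T :: "'t set" +
  fixes P :: "'a set"
  assumes prime: "prime_monoid_ideal Q P"
begin

abbreviation "F \<equiv> carrier Q - P"

abbreviation "QP \<equiv> loc_monoid Q P"

abbreviation "TP \<equiv> loc_module Q \<phi> T P"

abbreviation "frac \<equiv> loc_frac Q \<phi> T P"

abbreviation "frac_Q \<equiv> loc_frac Q (\<otimes>) (carrier Q) P"

abbreviation "act \<equiv> loc_act Q \<phi> T P"

lemma P_carrier: "p \<in> P \<Longrightarrow> p \<in> carrier Q"
  using prime by (auto simp: prime_monoid_ideal_def monoid_ideal_def)

lemma P_mult: "\<lbrakk>q \<in> carrier Q; p \<in> P\<rbrakk> \<Longrightarrow> q \<otimes> p \<in> P"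
  using prime by (auto simp: prime_monoid_ideal_def monoid_ideal_def)

lemma F_one: "\<one> \<in> F"
  using prime unfolding prime_monoid_ideal_def by (blast dest: submonoid.one_closed)

lemma F_mult: "\<lbrakk>f \<in> F; g \<in> F\<rbrakk> \<Longrightarrow> f \<otimes> g \<in> F"
  using prime unfolding prime_monoid_ideal_def by (blast dest: submonoid.m_closed)

lemma F_carrier: "f \<in> F \<Longrightarrow> f \<in> carrier Q"
  by simp

text \<open>
  The complement of an ideal contains the divisors of its elements, so \<open>F\<close> is a saturated submonoid.
\<close>
lemma F_mult_iff:
  assumes "x \<in> carrier Q" "y \<in> carrier Q"
  shows "x \<otimes> y \<in> F \<longleftrightarrow> x \<in> F \<and> y \<in> F"
  using assms F_mult P_mult[of x y] P_mult[of y x] by (auto simp: m_comm)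

lemma loc_rel_iff:
  "((t, f), (t', f')) \<in> loc_rel Q \<phi> T P \<longleftrightarrow> t \<in> T \<and> t' \<in> T \<and> f \<in> F \<and> f' \<in> F \<and>
     (\<exists>w\<in>F. \<phi> (w \<otimes> f') t = \<phi> (w \<otimes> f) t')"
  unfolding loc_rel_def by (auto simp: act_mult)

lemma equiv_loc_rel: "equiv (T \<times> F) (loc_rel Q \<phi> T P)"
proof (rule equivI)
  show "loc_rel Q \<phi> T P \<subseteq> (T \<times> F) \<times> (T \<times> F)"
    unfolding loc_rel_def by auto
  show "refl_on (T \<times> F) (loc_rel Q \<phi> T P)"
    using F_one by (auto simp: refl_on_def loc_rel_iff)
  show "sym (loc_rel Q \<phi> T P)"
    by (auto simp: sym_def loc_rel_def dest: sym)
  show "trans (loc_rel Q \<phi> T P)"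
  proof (rule transI)
    fix x y z assume "(x, y) \<in> loc_rel Q \<phi> T P" "(y, z) \<in> loc_rel Q \<phi> T P"
    moreover obtain t f t' f' t'' f'' where xyz: "x = (t, f)" "y = (t', f')" "z = (t'', f'')"
      by (metis surj_pair)
    ultimately obtain w v where
      w: "w \<in> F" "\<phi> (w \<otimes> f') t = \<phi> (w \<otimes> f) t'" and
      v: "v \<in> F" "\<phi> (v \<otimes> f'') t' = \<phi> (v \<otimes> f') t''" and
      mem: "t \<in> T" "f \<in> F" "t' \<in> T" "f' \<in> F" "t'' \<in> T" "f'' \<in> F"
      unfolding xyz loc_rel_iff by blast
    have "\<phi> ((w \<otimes> v \<otimes> f') \<otimes> f'') t = \<phi> (v \<otimes> f'') (\<phi> (w \<otimes> f') t)"
      using mem w(1) v(1) by (simp add: act_mult[symmetric] m_ac)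
    also have "\<dots> = \<phi> (w \<otimes> f) (\<phi> (v \<otimes> f'') t')"
      using mem w v(1) by (simp add: act_mult[symmetric] m_ac)
    also have "\<dots> = \<phi> ((w \<otimes> v \<otimes> f') \<otimes> f) t''"
      using mem w(1) v by (simp add: act_mult[symmetric] m_ac)
    finally show "(x, z) \<in> loc_rel Q \<phi> T P"
      unfolding xyz loc_rel_iff using mem F_mult[OF F_mult[OF w(1) v(1)] mem(4)] by blast
  qed
qed

lemma frac_eq_iff:
  assumes "t \<in> T" "f \<in> F" "t' \<in> T" "f' \<in> F"
  shows "frac t f = frac t' f' \<longleftrightarrow> (\<exists>u\<in>F. \<phi> (u \<otimes> f') t = \<phi> (u \<otimes> f) t')"
  unfolding loc_frac_def using eq_equiv_class_iff[OF equiv_loc_rel] assms loc_rel_iff by auto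

lemma loc_map_eq_iff:
  assumes "t \<in> T" "t' \<in> T"
  shows "frac t \<one> = frac t' \<one> \<longleftrightarrow> (\<exists>u\<in>F. \<phi> u t = \<phi> u t')"
  using assms frac_eq_iff[OF assms(1) F_one assms(2) F_one] by simp

lemma frac_in_TP: "\<lbrakk>t \<in> T; f \<in> F\<rbrakk> \<Longrightarrow> frac t f \<in> TP"
  unfolding loc_frac_def loc_module_def by (auto intro: quotientI)

lemma TP_cases:
  assumes "x \<in> TP"
  obtains t f where "t \<in> T" "f \<in> F" "x = frac t f"
  using assms unfolding loc_frac_def loc_module_def by (auto elim!: quotientE)

text \<open>
  \<open>Q\<close> is a module over itself, so that statements on \<open>T\<^sub>P\<close> specialize to statements on \<open>Q\<^sub>P\<close>.
\<close>
lemma regular: "localization Q (\<otimes>) (carrier Q) P"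
  using prime by unfold_locales (auto simp: m_assoc)

end

context localization
begin

interpretation reg: localization Q "(\<otimes>)" "carrier Q" P
  by (rule regular)

lemma act_frac:
  assumes "q \<in> carrier Q" "f \<in> F" "t \<in> T" "g \<in> F"
  shows "act (frac_Q q f) (frac t g) = frac (\<phi> q t) (f \<otimes> g)"
proof -
  have same: "frac (\<phi> q' t') (f' \<otimes> g') = frac (\<phi> q t) (f \<otimes> g)"
    if "(q', f') \<in> frac_Q q f" "(t', g') \<in> frac t g" for q' f' t' g'
  proof -
    from that(1) obtain w where w: "w \<in> F" "w \<otimes> f' \<otimes> q = w \<otimes> f \<otimes> q'"
      and q': "q' \<in> carrier Q" "f' \<in> F"
      unfolding loc_frac_def reg.loc_rel_iff Image_singleton_iff by blast
    from that(2) obtain v where v: "v \<in> F" "\<phi> (v \<otimes> g') t = \<phi> (v \<otimes> g) t'"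
      and t': "t' \<in> T" "g' \<in> F"
      unfolding loc_frac_def loc_rel_iff Image_singleton_iff by blast
    have "\<phi> ((w \<otimes> v) \<otimes> (f \<otimes> g)) (\<phi> q' t') = \<phi> (w \<otimes> f \<otimes> q') (\<phi> (v \<otimes> g) t')"
      using assms q' t' w(1) v(1) by (simp add: act_mult[symmetric] m_ac)
    also have "\<dots> = \<phi> (w \<otimes> f' \<otimes> q) (\<phi> (v \<otimes> g') t)"
      using w(2) v(2) by simp
    also have "\<dots> = \<phi> ((w \<otimes> v) \<otimes> (f' \<otimes> g')) (\<phi> q t)"
      using assms q' t' w(1) v(1) by (simp add: act_mult[symmetric] m_ac)
    finally have *: "\<phi> ((w \<otimes> v) \<otimes> (f \<otimes> g)) (\<phi> q' t') = \<phi> ((w \<otimes> v) \<otimes> (f' \<otimes> g')) (\<phi> q t)" .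
    show ?thesis
    proof (subst frac_eq_iff)
      show "\<exists>u\<in>F. \<phi> (u \<otimes> (f \<otimes> g)) (\<phi> q' t') = \<phi> (u \<otimes> (f' \<otimes> g')) (\<phi> q t)"
        using * F_mult[OF w(1) v(1)] by blast
    qed (use assms q' t' F_mult act_closed in auto)
  qed
  have self: "(q, f) \<in> frac_Q q f" "(t, g) \<in> frac t g"
    unfolding loc_frac_def using assms
    by (intro equiv_class_self[OF equiv_loc_rel] equiv_class_self[OF reg.equiv_loc_rel]; simp)+
  show ?thesis
  proof (intro equalityI subsetI)
    fix z assume "z \<in> act (frac_Q q f) (frac t g)"
    then obtain q' f' t' g' where "(q', f') \<in> frac_Q q f" "(t', g') \<in> frac t g"
      "z \<in> frac (\<phi> q' t') (f' \<otimes> g')"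
      unfolding loc_act_def by blast
    then show "z \<in> frac (\<phi> q t) (f \<otimes> g)" using same by blast
  next
    fix z assume "z \<in> frac (\<phi> q t) (f \<otimes> g)"
    then show "z \<in> act (frac_Q q f) (frac t g)"
      unfolding loc_act_def using self by blast
  qed
qed

end

context localization
begin

interpretation reg: localization Q "(\<otimes>)" "carrier Q" P
  by (rule regular)

text \<open>
  The context is reopened so that the regular module inherits \<open>act_frac\<close> as
  its multiplication formula.
\<close>
lemma QP_simps:
  "carrier QP = reg.TP" "monoid.mult QP = reg.act" "\<one>\<^bsub>QP\<^esub> = frac_Q \<one> \<one>"
  by (simp_all add: loc_monoid_def)

lemma QP_cases:
  assumes "x \<in> carrier QP"
  obtains q f where "q \<in> carrier Q" "f \<in> F" "x = frac_Q q f"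
  using assms reg.TP_cases by (auto simp: QP_simps)

lemma frac_in_QP: "\<lbrakk>q \<in> carrier Q; f \<in> F\<rbrakk> \<Longrightarrow> frac_Q q f \<in> carrier QP"
  by (simp add: QP_simps reg.frac_in_TP)

lemma loc_map_in_QP: "q \<in> carrier Q \<Longrightarrow> frac_Q q \<one> \<in> carrier QP"
  by (intro frac_in_QP F_one)

lemma mult_frac:
  assumes "q \<in> carrier Q" "f \<in> F" "q' \<in> carrier Q" "f' \<in> F"
  shows "frac_Q q f \<otimes>\<^bsub>QP\<^esub> frac_Q q' f' = frac_Q (q \<otimes> q') (f \<otimes> f')"
  unfolding QP_simps by (rule reg.act_frac[OF assms])

lemma comm_monoid_QP: "comm_monoid QP"
proof (rule comm_monoidI)
  show "\<one>\<^bsub>QP\<^esub> \<in> carrier QP"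
    by (simp add: QP_simps(3) loc_map_in_QP)
next
  fix x y assume "x \<in> carrier QP" "y \<in> carrier QP"
  then show "x \<otimes>\<^bsub>QP\<^esub> y \<in> carrier QP" "x \<otimes>\<^bsub>QP\<^esub> y = y \<otimes>\<^bsub>QP\<^esub> x"
    by (auto elim!: QP_cases simp: mult_frac m_comm intro!: frac_in_QP F_mult)
next
  fix x assume "x \<in> carrier QP"
  then show "\<one>\<^bsub>QP\<^esub> \<otimes>\<^bsub>QP\<^esub> x = x"
    using F_one by (auto elim!: QP_cases simp: QP_simps(3) mult_frac)
next
  fix x y z assume "x \<in> carrier QP" "y \<in> carrier QP" "z \<in> carrier QP"
  then obtain q f q' f' q'' f'' where
    "q \<in> carrier Q" "f \<in> F" "x = frac_Q q f" "q' \<in> carrier Q" "f' \<in> F" "y = frac_Q q' f'"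
    "q'' \<in> carrier Q" "f'' \<in> F" "z = frac_Q q'' f''"
    by (metis QP_cases)
  then show "x \<otimes>\<^bsub>QP\<^esub> y \<otimes>\<^bsub>QP\<^esub> z = x \<otimes>\<^bsub>QP\<^esub> (y \<otimes>\<^bsub>QP\<^esub> z)"
    using F_mult[of f f'] F_mult[of f' f''] by (simp add: mult_frac m_assoc)
qed

lemma monoid_module_TP: "monoid_module QP act TP"
proof -
  interpret QP: comm_monoid QP by (rule comm_monoid_QP)
  show ?thesis
  proof
    fix x y assume "x \<in> carrier QP" "y \<in> TP"
    then show "act x y \<in> TP"
      by (elim QP_cases TP_cases) (auto simp: act_frac intro!: frac_in_TP F_mult act_closed)
  next
    fix y assume "y \<in> TP"
    then show "act \<one>\<^bsub>QP\<^esub> y = y"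
      using F_one by (elim TP_cases) (simp add: QP_simps(3) act_frac act_one)
  next
    fix x x' y assume "x \<in> carrier QP" "x' \<in> carrier QP" "y \<in> TP"
    then obtain q f q' f' t g where
      "q \<in> carrier Q" "f \<in> F" "x = frac_Q q f" "q' \<in> carrier Q" "f' \<in> F" "x' = frac_Q q' f'"
      "t \<in> T" "g \<in> F" "y = frac t g"
      by (metis QP_cases TP_cases)
    then show "act (x \<otimes>\<^bsub>QP\<^esub> x') y = act x (act x' y)"
      using F_mult[of f f'] F_mult[of f' g]
      by (simp add: mult_frac act_frac act_closed act_mult m_assoc)
  qed
qed

lemma act_loc_map:
  assumes "q \<in> carrier Q" "t \<in> T"
  shows "act (frac_Q q \<one>) (frac t \<one>) = frac (\<phi> q t) \<one>"
  using act_frac[OF assms(1) F_one assms(2) F_one] by simp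

text \<open>
  It suffices to test the elements of \<open>Q\<close>: if \<open>u\<close> and \<open>v\<close> in \<open>F\<close> witness that \<open>q\<close> and \<open>f\<close> fix the image
  of \<open>w\<close>, then \<open>uv\<close> witnesses that the fraction of \<open>q\<close> by \<open>f\<close> does.
\<close>
lemma loc_nil_iff:
  assumes "w \<in> T"
  shows "frac w \<one> \<in> loc_nil Q \<phi> T P \<longleftrightarrow> (\<forall>q\<in>carrier Q. \<exists>u\<in>F. \<phi> u (\<phi> q w) = \<phi> u w)"
    (is "?L \<longleftrightarrow> ?R")
proof -
  interpret TP: monoid_module QP act TP by (rule monoid_module_TP)
  have nil: "?L \<longleftrightarrow> (\<forall>x\<in>carrier QP. act x (frac w \<one>) = frac w \<one>)"
    unfolding loc_nil_def TP.nil_iff using assms frac_in_TP F_one by auto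
  show ?thesis
  proof
    assume ?L
    then have "frac (\<phi> q w) \<one> = frac w \<one>" if "q \<in> carrier Q" for q
      using nil that assms loc_map_in_QP act_loc_map by metis
    then show ?R using assms loc_map_eq_iff act_closed by metis
  next
    assume R: ?R
    have "act (frac_Q q f) (frac w \<one>) = frac w \<one>" if q: "q \<in> carrier Q" "f \<in> F" for q f
    proof -
      obtain u v where u: "u \<in> F" "\<phi> u (\<phi> q w) = \<phi> u w" and v: "v \<in> F" "\<phi> v (\<phi> f w) = \<phi> v w"
        using R q by (metis F_carrier)
      have "\<phi> (u \<otimes> v) (\<phi> q w) = \<phi> v (\<phi> u (\<phi> q w))"
        using u(1) v(1) q assms by (simp add: act_mult[symmetric] m_ac)
      also have "\<dots> = \<phi> u (\<phi> v w)"
        using u v(1) assms by (simp add: act_commute)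
      also have "\<dots> = \<phi> (u \<otimes> v \<otimes> f) w"
        using u(1) v q assms by (simp add: act_mult act_closed)
      finally have "\<exists>u\<in>F. \<phi> (u \<otimes> \<one>) (\<phi> q w) = \<phi> (u \<otimes> f) w"
        using F_mult[OF u(1) v(1)] by (intro bexI[of _ "u \<otimes> v"]) (use u v in auto)
      then show ?thesis
        using q assms F_one by (simp add: act_frac frac_eq_iff act_closed)
    qed
    then show ?L unfolding nil by (auto elim: QP_cases)
  qed
qed

lemma loc_nil_of_nil:
  assumes "w \<in> nil_elements Q \<phi> T"
  shows "frac w \<one> \<in> loc_nil Q \<phi> T P"
  using assms F_one loc_nil_iff[of w] nil_iff[of w] by auto

section \<open>Prime congruences\<close>

lemma loc_map_Units_iff:
  assumes "q \<in> carrier Q"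
  shows "frac_Q q \<one> \<in> Units QP \<longleftrightarrow> q \<in> F"
proof
  assume "frac_Q q \<one> \<in> Units QP"
  then obtain y where y: "y \<in> carrier QP" "frac_Q q \<one> \<otimes>\<^bsub>QP\<^esub> y = \<one>\<^bsub>QP\<^esub>"
    by (auto simp: Units_def)
  from y(1) obtain r f where r: "r \<in> carrier Q" "f \<in> F" "y = frac_Q r f" by (rule QP_cases)
  have "frac_Q (q \<otimes> r) f = frac_Q \<one> \<one>"
    using y(2) r assms F_one by (simp add: mult_frac QP_simps(3))
  then obtain u where "u \<in> F" "u \<otimes> (q \<otimes> r) = u \<otimes> f"
    using r assms F_one by (auto simp: reg.frac_eq_iff)
  then have "u \<otimes> (q \<otimes> r) \<in> F" using F_mult[of u f] r by simp
  then show "q \<in> F" using \<open>u \<in> F\<close> r(1) assms F_mult_iff m_closed F_carrier by metis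
next
  assume q: "q \<in> F"
  have "frac_Q q \<one> \<otimes>\<^bsub>QP\<^esub> frac_Q \<one> q = \<one>\<^bsub>QP\<^esub>"
    using q F_one by (simp add: mult_frac QP_simps(3) reg.frac_eq_iff) blast
  then show "frac_Q q \<one> \<in> Units QP"
    using q comm_monoid.m_comm[OF comm_monoid_QP, of "frac_Q q \<one>" "frac_Q \<one> q"]
      frac_in_QP[of \<one> q] loc_map_in_QP[of q]
    by (auto simp: Units_def)
qed

text \<open>
  The ideal generated by the image of \<open>P\<close> consists of the fractions with numerator in \<open>P\<close>.
\<close>
lemma loc_map_ideal_iff:
  assumes "q \<in> carrier Q"
  shows "frac_Q q \<one> \<in> loc_ideal Q P \<longleftrightarrow> q \<in> P"
proof
  assume "q \<in> P"
  then show "frac_Q q \<one> \<in> loc_ideal Q P"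
    unfolding loc_ideal_def by (intro subsetD[OF hull_subset]) auto
next
  let ?J = "{frac_Q p f |p f. p \<in> P \<and> f \<in> F}"
  have "monoid_ideal QP ?J"
    unfolding monoid_ideal_def
  proof (intro conjI ballI subsetI)
    fix x assume "x \<in> ?J"
    then show "x \<in> carrier QP" using P_carrier frac_in_QP by auto
  next
    fix x y assume "x \<in> carrier QP" "y \<in> ?J"
    then obtain q f p g where "q \<in> carrier Q" "f \<in> F" "x = frac_Q q f" "p \<in> P" "g \<in> F"
      "y = frac_Q p g"
      by (auto elim!: QP_cases)
    then show "x \<otimes>\<^bsub>QP\<^esub> y \<in> ?J"
      using P_mult[of q p] F_mult[of f g] P_carrier[of p] by (auto simp: mult_frac)
  qed
  moreover have "loc_monoid_map Q P ` P \<subseteq> ?J" using F_one by auto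
  ultimately have "loc_ideal Q P \<subseteq> ?J" unfolding loc_ideal_def by (intro hull_minimal)
  moreover assume "frac_Q q \<one> \<in> loc_ideal Q P"
  ultimately obtain p f where p: "p \<in> P" "f \<in> F" "frac_Q q \<one> = frac_Q p f" by auto
  then obtain u where u: "u \<in> F" "u \<otimes> f \<otimes> q = u \<otimes> p"
    using assms F_one P_carrier by (auto simp: reg.frac_eq_iff)
  have "u \<otimes> f \<otimes> q \<in> P" using u p P_mult[of u p] by simp
  then show "q \<in> P" using F_mult[OF F_mult[OF u(1) p(2)], of q] assms by auto
qed

lemma stabilizer_iff:
  assumes w: "w \<in> T" and x: "x \<in> Units QP" and y: "y \<in> Units QP"
  shows "x \<otimes>\<^bsub>QP\<^esub> inv\<^bsub>QP\<^esub> y \<in> loc_stabilizer Q \<phi> T P w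
    \<longleftrightarrow> act x (frac w \<one>) = act y (frac w \<one>)"
proof -
  interpret TP: monoid_module QP act TP by (rule monoid_module_TP)
  let ?w = "frac w \<one>"
  have wT: "?w \<in> TP" using w F_one by (rule frac_in_TP)
  have c: "x \<in> carrier QP" "y \<in> carrier QP" "inv\<^bsub>QP\<^esub> y \<in> carrier QP"
    using x y by auto
  have "x \<otimes>\<^bsub>QP\<^esub> inv\<^bsub>QP\<^esub> y \<in> loc_stabilizer Q \<phi> T P w
      \<longleftrightarrow> act (x \<otimes>\<^bsub>QP\<^esub> inv\<^bsub>QP\<^esub> y) ?w = ?w"
    using x y by (simp add: loc_stabilizer_def stabilizer_def units_of_carrier)
  also have "\<dots> \<longleftrightarrow> act x ?w = act y ?w"
  proof
    assume "act (x \<otimes>\<^bsub>QP\<^esub> inv\<^bsub>QP\<^esub> y) ?w = ?w"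
    then have "act y ?w = act (y \<otimes>\<^bsub>QP\<^esub> (x \<otimes>\<^bsub>QP\<^esub> inv\<^bsub>QP\<^esub> y)) ?w"
      using c wT by (simp add: TP.act_mult)
    also have "y \<otimes>\<^bsub>QP\<^esub> (x \<otimes>\<^bsub>QP\<^esub> inv\<^bsub>QP\<^esub> y) = x"
      using c y by (metis TP.Units_r_inv TP.m_lcomm TP.r_one)
    finally show "act x ?w = act y ?w" ..
  next
    assume eq: "act x ?w = act y ?w"
    have "act (x \<otimes>\<^bsub>QP\<^esub> inv\<^bsub>QP\<^esub> y) ?w = act (inv\<^bsub>QP\<^esub> y) (act x ?w)"
      using c wT by (metis TP.act_mult TP.m_comm)
    also have "\<dots> = act (inv\<^bsub>QP\<^esub> y \<otimes>\<^bsub>QP\<^esub> y) ?w"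
      using c wT by (simp add: eq TP.act_mult)
    finally show "act (x \<otimes>\<^bsub>QP\<^esub> inv\<^bsub>QP\<^esub> y) ?w = ?w"
      using y wT by (simp add: TP.act_one)
  qed
  finally show ?thesis .
qed

text \<open>
  The prime congruence described without \<open>Q\<^sub>P\<close>: an element of \<open>P\<close> goes into the ideal \<open>P\<^sub>P\<close>, an
  element of \<open>F\<close> becomes a unit, and two units are congruent if they move the image of \<open>w\<close> to
  the same place.
\<close>
lemma prime_congruence_iff:
  assumes w: "w \<in> T"
  shows "(a, b) \<in> prime_congruence Q \<phi> T P w \<longleftrightarrow>
    a \<in> P \<and> b \<in> P \<or> a \<in> F \<and> b \<in> F \<and> (\<exists>u\<in>F. \<phi> u (\<phi> a w) = \<phi> u (\<phi> b w))"
proof -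
  let ?cong = "loc_congruence Q \<phi> T P w" and ?w = "frac w \<one>"
  have P_class: "?cong `` {frac_Q q \<one>} = loc_ideal Q P" if "q \<in> P" for q
    using that P_carrier loc_map_ideal_iff loc_map_Units_iff
    by (auto simp: loc_congruence_def)
  have F_class: "?cong `` {frac_Q q \<one>} = {x \<in> Units QP. act (frac_Q q \<one>) ?w = act x ?w}"
    if "q \<in> F" for q
    using that loc_map_ideal_iff[of q] loc_map_Units_iff[of q] stabilizer_iff[OF w]
    by (auto simp: loc_congruence_def)
  have differ: "?cong `` {frac_Q p \<one>} \<noteq> ?cong `` {frac_Q f \<one>}" if "p \<in> P" "f \<in> F" for p f
  proof -
    have "frac_Q f \<one> \<in> ?cong `` {frac_Q f \<one>}"
      unfolding F_class[OF that(2)] using that loc_map_Units_iff[of f] by auto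
    moreover have "frac_Q f \<one> \<notin> ?cong `` {frac_Q p \<one>}"
      unfolding P_class[OF that(1)] using that loc_map_ideal_iff[of f] by auto
    ultimately show ?thesis by metis
  qed
  have FF: "?cong `` {frac_Q f \<one>} = ?cong `` {frac_Q g \<one>}
      \<longleftrightarrow> (\<exists>u\<in>F. \<phi> u (\<phi> f w) = \<phi> u (\<phi> g w))" if "f \<in> F" "g \<in> F" for f g
  proof -
    have "?cong `` {frac_Q f \<one>} = ?cong `` {frac_Q g \<one>}
        \<longleftrightarrow> act (frac_Q f \<one>) ?w = act (frac_Q g \<one>) ?w"
      unfolding F_class[OF that(1)] F_class[OF that(2)]
      using that loc_map_Units_iff[of g] by auto
    also have "\<dots> \<longleftrightarrow> frac (\<phi> f w) \<one> = frac (\<phi> g w) \<one>"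
      using that w by (simp add: act_loc_map)
    finally show ?thesis using that w by (simp add: loc_map_eq_iff act_closed)
  qed
  show ?thesis
    unfolding prime_congruence_def ker_on_def
    using P_class[of a] P_class[of b] differ[of a b] differ[of b a] FF[of a b] P_carrier
    by (cases "a \<in> P"; cases "b \<in> P") (simp, blast)+
qed

section \<open>Key witnesses\<close>

lemma common_ker_iff:
  "(x, y) \<in> common_ker Q \<phi> T P \<longleftrightarrow>
     x \<in> TP \<and> y \<in> TP \<and> (\<forall>p\<in>P. act (frac_Q p \<one>) x = act (frac_Q p \<one>) y)"
  by (auto simp: common_ker_def ker_on_def)

text \<open>
  The images of \<open>a\<close> and \<open>b\<close> lie in one class of the common kernel.  Each of them is maximal there
  if it is nil, so that the other one is not exclusively maximal; and if neither is nil, at most one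
  of them is exclusively maximal.  By the last assumption they are not both nil, as their
  images would be equal.
\<close>
lemma key_witness_of_pair:
  assumes ab: "a \<in> T" "b \<in> T"
    and distinct: "\<And>u. u \<in> F \<Longrightarrow> \<phi> u a \<noteq> \<phi> u b"
    and agree: "\<And>p. p \<in> P \<Longrightarrow> \<exists>u\<in>F. \<phi> u (\<phi> p a) = \<phi> u (\<phi> p b)"
    and q: "q \<in> carrier Q" "q' \<in> carrier Q" "\<phi> q a = \<phi> q' b"
  shows "key_witness Q \<phi> T P a \<or> key_witness Q \<phi> T P b"
proof -
  interpret TP: monoid_module QP act TP by (rule monoid_module_TP)
  let ?a = "frac a \<one>" and ?b = "frac b \<one>"
  let ?C = "common_ker Q \<phi> T P `` {?a}"
  have TP: "?a \<in> TP" "?b \<in> TP" using ab F_one by (auto intro: frac_in_TP)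
  have ne: "?a \<noteq> ?b" using distinct ab by (auto simp: loc_map_eq_iff)
  have "act (frac_Q p \<one>) ?a = act (frac_Q p \<one>) ?b" if "p \<in> P" for p
    using that agree[OF that] ab P_carrier by (simp add: act_loc_map loc_map_eq_iff act_closed)
  then have C: "?a \<in> ?C" "?b \<in> ?C" "common_ker Q \<phi> T P `` {?b} = ?C"
    using TP by (auto simp: common_ker_iff)
  then have not_singleton: "\<not> is_singleton ?C"
    using ne by (metis is_singleton_def singletonD)
  have nil_maximal: "x \<in> green_maximals QP act ?C" if "x \<in> loc_nil Q \<phi> T P" "x \<in> ?C" for x
  proof -
    have "green_le QP act y x" if "y \<in> ?C" "green_le QP act x y" for y
    proof -
      have "act \<one>\<^bsub>QP\<^esub> y = y" using that(1) by (intro TP.act_one) (auto simp: common_ker_iff)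
      then have "y \<in> orbit QP act y" using TP.one_closed unfolding orbit_def by force
      then have "y = x"
        using that(2) \<open>x \<in> loc_nil Q \<phi> T P\<close>
        by (auto simp: green_le_def loc_nil_def nil_elements_def)
      then show ?thesis by (simp add: green_le_def)
    qed
    then show ?thesis using that(2) by (auto simp: green_maximals_def)
  qed
  have "\<not> (?a \<in> loc_nil Q \<phi> T P \<and> ?b \<in> loc_nil Q \<phi> T P)"
  proof
    assume "?a \<in> loc_nil Q \<phi> T P \<and> ?b \<in> loc_nil Q \<phi> T P"
    then have "act (frac_Q q \<one>) ?a = ?a" "act (frac_Q q' \<one>) ?b = ?b"
      using q loc_map_in_QP unfolding loc_nil_def TP.nil_iff by auto
    then show False using q ab ne by (simp add: act_loc_map)
  qed
  then consider "?a \<notin> loc_nil Q \<phi> T P" "?b \<notin> loc_nil Q \<phi> T P"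
    | "?a \<in> loc_nil Q \<phi> T P" "?b \<notin> loc_nil Q \<phi> T P"
    | "?a \<notin> loc_nil Q \<phi> T P" "?b \<in> loc_nil Q \<phi> T P"
    by blast
  then show ?thesis
  proof cases
    case 1
    then show ?thesis
      using ab not_singleton ne C(3) by (auto simp: key_witness_def exclusively_maximal_def)
  next
    case 2
    then have "\<not> exclusively_maximal Q \<phi> T P b ?C"
      using nil_maximal C ne by (auto simp: exclusively_maximal_def)
    then show ?thesis
      using ab not_singleton 2 C(3) by (auto simp: key_witness_def)
  next
    case 3
    then have "\<not> exclusively_maximal Q \<phi> T P a ?C"
      using nil_maximal C ne by (auto simp: exclusively_maximal_def)
    then show ?thesis
      using ab not_singleton 3 by (auto simp: key_witness_def)
  qed
qed

lemma key_witness_not_nil: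
  assumes "key_witness Q \<phi> T P w"
  shows "w \<in> T" "w \<notin> nil_elements Q \<phi> T"
  using assms loc_nil_of_nil by (auto simp: key_witness_def)

text \<open>
  A nilpotent \<open>f\<close> that becomes invertible in \<open>Q\<^sub>P\<close> makes every element of \<open>T\<^sub>P\<close> nil.
\<close>
lemma key_witness_F_not_nilpotent:
  assumes key: "key_witness Q \<phi> T P w" and f: "f \<in> F"
  shows "\<not> acts_nilpotently Q \<phi> T f"
proof
  assume "acts_nilpotently Q \<phi> T f"
  moreover have w: "w \<in> T" using key by (rule key_witness_not_nil)
  ultimately obtain n :: nat where n: "\<phi> (f [^] n) w \<in> nil_elements Q \<phi> T"
    by (auto simp: acts_nilpotently_def)
  have fn: "f [^] n \<in> F" by (induction n) (use f F_one F_mult in auto)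
  have "\<phi> (f [^] n) (\<phi> q w) = \<phi> (f [^] n) w" if "q \<in> carrier Q" for q
    using n fn that w act_commute[of q "f [^] n" w] by (auto simp: nil_iff)
  then have "frac w \<one> \<in> loc_nil Q \<phi> T P" using w fn by (auto simp: loc_nil_iff)
  then show False using key by (simp add: key_witness_def)
qed

text \<open>
  A cancellative \<open>p\<close> stays injective on \<open>T\<^sub>P\<close>, and the kernel of an injective map has singleton
  classes.
\<close>
lemma key_witness_P_not_cancellative:
  assumes key: "key_witness Q \<phi> T P w" and p: "p \<in> P"
  shows "\<not> acts_cancellatively \<phi> T p"
proof
  assume inj: "acts_cancellatively \<phi> T p"
  have w: "w \<in> T" using key by (rule key_witness_not_nil)
  have "y = frac w \<one>" if y: "(frac w \<one>, y) \<in> common_ker Q \<phi> T P" for y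
  proof -
    from y have "y \<in> TP" by (simp add: common_ker_iff)
    then obtain t f where t: "t \<in> T" "f \<in> F" "y = frac t f" by (rule TP_cases)
    have "frac (\<phi> p w) \<one> = frac (\<phi> p t) f"
      using y t w p P_carrier F_one by (auto simp: common_ker_iff act_frac)
    then obtain u where u: "u \<in> F" "\<phi> (u \<otimes> f) (\<phi> p w) = \<phi> u (\<phi> p t)"
      using t w p P_carrier F_one by (auto simp: frac_eq_iff act_closed)
    have "\<phi> p (\<phi> (u \<otimes> f) w) = \<phi> p (\<phi> u t)"
      using u t w p P_carrier by (simp add: act_commute)
    then have "\<phi> (u \<otimes> f) w = \<phi> u t"
      using inj u t w by (auto simp: acts_cancellatively_def inj_on_def act_closed)
    then have "frac w \<one> = frac t f"
      using u(1) t w F_one by (auto simp: frac_eq_iff)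
    then show ?thesis using t by simp
  qed
  moreover have "(frac w \<one>, frac w \<one>) \<in> common_ker Q \<phi> T P"
    using w F_one by (simp add: common_ker_iff frac_in_TP)
  ultimately have "common_ker Q \<phi> T P `` {frac w \<one>} = {frac w \<one>}" by blast
  then show False using key by (simp add: key_witness_def)
qed

end

context monoid_module
begin

lemma localizationI: "prime_monoid_ideal Q P \<Longrightarrow> localization Q \<phi> T P"
  by unfold_locales

text \<open>
  Let \<open>x\<close> lie in \<open>P'\<close> but not in \<open>P\<close>.  From the side of \<open>P'\<close>, \<open>x\<close> is congruent to \<open>xx\<close> but not
  to \<open>1\<close>.  From the side of \<open>P\<close>, \<open>x\<close> is a unit and can be cancelled in the first of these,
  which makes \<open>1\<close> congruent to \<open>x\<close>.
\<close>
lemma prime_congruence_determines_prime: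
  assumes P: "prime_monoid_ideal Q P" "w \<in> T" and P': "prime_monoid_ideal Q P'" "w' \<in> T"
    and eq: "prime_congruence Q \<phi> T P w = prime_congruence Q \<phi> T P' w'"
  shows "P = P'"
proof -
  have sub: "P' \<subseteq> P"
    if P: "prime_monoid_ideal Q P" "w \<in> T" and P': "prime_monoid_ideal Q P'" "w' \<in> T"
      and eq: "prime_congruence Q \<phi> T P w = prime_congruence Q \<phi> T P' w'" for P P' w w'
  proof (rule subsetI, rule ccontr)
    interpret l: localization Q \<phi> T P using P(1) by (rule localizationI)
    interpret l': localization Q \<phi> T P' using P'(1) by (rule localizationI)
    fix x assume x: "x \<in> P'" "x \<notin> P"
    then have xF: "x \<in> l.F" using l'.P_carrier by auto
    have "(x, x \<otimes> x) \<in> prime_congruence Q \<phi> T P' w'"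
      using x l'.P_mult l'.P_carrier P'(2) by (auto simp: l'.prime_congruence_iff)
    then obtain u where u: "u \<in> l.F" "\<phi> u (\<phi> x w) = \<phi> u (\<phi> (x \<otimes> x) w)"
      using x P(2) unfolding eq[symmetric] l.prime_congruence_iff[OF P(2)] by auto
    have "\<phi> (u \<otimes> x) (\<phi> \<one> w) = \<phi> (u \<otimes> x) (\<phi> x w)"
      using u P(2) xF by (simp add: act_mult act_closed act_one)
    then have "(\<one>, x) \<in> prime_congruence Q \<phi> T P w"
      using l.F_mult[OF u(1) xF] xF l.F_one unfolding l.prime_congruence_iff[OF P(2)] by blast
    then show False
      using x l'.F_one unfolding eq l'.prime_congruence_iff[OF P'(2)] by auto
  qed
  show ?thesis using sub[OF P P' eq] sub[OF P' P eq[symmetric]] by auto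
qed

text \<open>
  The source of all key witnesses.  The prime is a maximal proper ideal of elements identifying
  \<open>ca\<close> and \<open>cb\<close> up to \<open>M\<close>.  It can be steered: elements to be avoided are put into \<open>M\<close>, and an
  element that identifies \<open>a\<close> and \<open>b\<close> is forced into it.
\<close>
lemma separated_pair_has_key_witness:
  assumes noeth: "noetherian_monoid Q" and M: "submonoid M Q"
    and ab: "a \<in> T" "b \<in> T"
    and q: "q \<in> carrier Q" "q' \<in> carrier Q" "\<phi> q a = \<phi> q' b"
    and distinct: "\<And>u. u \<in> M \<Longrightarrow> \<phi> u a \<noteq> \<phi> u b"
  obtains P c where "prime_monoid_ideal Q P" "P \<inter> M = {}"
    "\<And>r u. r \<in> carrier Q \<Longrightarrow> u \<in> M \<Longrightarrow> \<phi> u (\<phi> r a) = \<phi> u (\<phi> r b) \<Longrightarrow> r \<in> P"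
    "c \<in> carrier Q" "\<phi> c a \<noteq> \<phi> c b"
    "key_witness Q \<phi> T P (\<phi> c a) \<or> key_witness Q \<phi> T P (\<phi> c b)"
proof -
  have M_carrier: "u \<in> carrier Q" if "u \<in> M" for u
    using M that by (meson submonoid.subset subsetD)
  have M_one: "\<one> \<in> M" using M by (rule submonoid.one_closed)
  have M_mult: "u \<otimes> v \<in> M" if "u \<in> M" "v \<in> M" for u v
    using M that by (rule submonoid.m_closed)
  \<comment> \<open>Elements that identify \<open>ca\<close> and \<open>cb\<close> after multiplication with some element of \<open>M\<close>.  A maximal
    proper ideal of this form is prime, by the argument for annihilators in commutative algebra.\<close>
  define I where "I c = {r \<in> carrier Q. \<exists>u\<in>M. \<phi> (u \<otimes> r \<otimes> c) a = \<phi> (u \<otimes> r \<otimes> c) b}" for c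
  have mult_eq: "\<phi> (s \<otimes> r) a = \<phi> (s \<otimes> r) b"
    if "\<phi> r a = \<phi> r b" "r \<in> carrier Q" "s \<in> carrier Q" for r s
    using that ab by (simp add: act_mult)
  have I_mono: "I c \<subseteq> I (s \<otimes> c)" if c: "c \<in> carrier Q" "s \<in> carrier Q" for c s
  proof
    fix r assume "r \<in> I c"
    then obtain u where u: "r \<in> carrier Q" "u \<in> M" "\<phi> (u \<otimes> r \<otimes> c) a = \<phi> (u \<otimes> r \<otimes> c) b"
      by (auto simp: I_def)
    have "s \<otimes> (u \<otimes> r \<otimes> c) = u \<otimes> r \<otimes> (s \<otimes> c)"
      using u c M_carrier by (simp add: m_ac)
    then show "r \<in> I (s \<otimes> c)"
      using mult_eq[OF u(3), of s] u c M_carrier by (auto simp: I_def)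
  qed
  have I_ideal: "monoid_ideal Q (I c)" if c: "c \<in> carrier Q" for c
    unfolding monoid_ideal_def
  proof (intro conjI ballI)
    show "I c \<subseteq> carrier Q" by (auto simp: I_def)
    fix s r assume s: "s \<in> carrier Q" and "r \<in> I c"
    then obtain u where u: "r \<in> carrier Q" "u \<in> M" "\<phi> (u \<otimes> r \<otimes> c) a = \<phi> (u \<otimes> r \<otimes> c) b"
      by (auto simp: I_def)
    have "s \<otimes> (u \<otimes> r \<otimes> c) = u \<otimes> (s \<otimes> r) \<otimes> c"
      using u c s M_carrier by (simp add: m_ac)
    then show "s \<otimes> r \<in> I c"
      using mult_eq[OF u(3), of s] u c s M_carrier by (auto simp: I_def)
  qed
  let ?A = "{I c |c. c \<in> carrier Q \<and> \<one> \<notin> I c}"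
  have "\<one> \<notin> I \<one>"
    using distinct M_carrier by (auto simp: I_def)
  then have "?A \<noteq> {}" by blast
  then obtain P where "P \<in> ?A" and P_max: "\<And>J. J \<in> ?A \<Longrightarrow> P \<subseteq> J \<Longrightarrow> J = P"
    using noetherian_maximal_ideal_exists[OF noeth, of ?A] I_ideal by blast
  then obtain c where c: "c \<in> carrier Q" "\<one> \<notin> I c" "P = I c" by auto
  have prime: "prime_monoid_ideal Q P"
    unfolding prime_monoid_ideal_def
  proof
    show "monoid_ideal Q P" using c I_ideal by simp
    show "submonoid (carrier Q - P) Q"
    proof
      fix r s assume rs: "r \<in> carrier Q - P" "s \<in> carrier Q - P"
      have eq: "u \<otimes> (r \<otimes> s) \<otimes> c = u \<otimes> r \<otimes> (s \<otimes> c)" if "u \<in> M" for u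
        using that rs c M_carrier by (simp add: m_ac)
      \<comment> \<open>As \<open>s\<close> is not in \<open>I c\<close>, the ideal \<open>I (s \<otimes> c)\<close> is proper; it contains \<open>I c\<close>, hence equals it.\<close>
      have "\<one> \<notin> I (s \<otimes> c)"
      proof
        assume "\<one> \<in> I (s \<otimes> c)"
        then obtain u where "u \<in> M" "\<phi> (u \<otimes> s \<otimes> c) a = \<phi> (u \<otimes> s \<otimes> c) b"
          using rs c M_carrier by (auto simp: I_def m_assoc)
        then show False using rs c by (auto simp: I_def)
      qed
      then have "I (s \<otimes> c) = P"
        using rs c I_mono[of c s] by (intro P_max) auto
      then have "r \<notin> I (s \<otimes> c)" using rs by simp
      then have "r \<otimes> s \<notin> I c" using rs eq by (auto simp: I_def)
      then show "r \<otimes> s \<in> carrier Q - P" using rs c by simp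
    qed (use c in auto)
  qed
  interpret l: localization Q \<phi> T P using prime by (rule localizationI)
  have disjoint: "P \<inter> M = {}"
  proof (rule ccontr)
    assume "P \<inter> M \<noteq> {}"
    then obtain u v where "u \<in> M" "v \<in> M" "\<phi> (v \<otimes> u \<otimes> c) a = \<phi> (v \<otimes> u \<otimes> c) b"
      using c by (auto simp: I_def)
    then have "\<one> \<in> I c" using M_mult[of v u] M_carrier by (auto simp: I_def)
    then show False using c by simp
  qed
  have not_F: "\<phi> u (\<phi> c a) \<noteq> \<phi> u (\<phi> c b)" if u: "u \<in> l.F" for u
  proof
    assume "\<phi> u (\<phi> c a) = \<phi> u (\<phi> c b)"
    then have "u \<in> I c" using u c ab M_one unfolding I_def
      by (auto simp: act_mult intro!: bexI[of _ \<one>])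
    then show False using u c by simp
  qed
  have "key_witness Q \<phi> T P (\<phi> c a) \<or> key_witness Q \<phi> T P (\<phi> c b)"
  proof (rule l.key_witness_of_pair)
    fix p assume p: "p \<in> P"
    then obtain u where "u \<in> M" "\<phi> (u \<otimes> p \<otimes> c) a = \<phi> (u \<otimes> p \<otimes> c) b"
      using c by (auto simp: I_def)
    then show "\<exists>u\<in>l.F. \<phi> u (\<phi> p (\<phi> c a)) = \<phi> u (\<phi> p (\<phi> c b))"
      using disjoint p l.P_carrier M_carrier c ab by (auto simp: act_mult act_closed)
  next
    show "\<phi> q (\<phi> c a) = \<phi> q' (\<phi> c b)"
      using q ab c by (simp add: act_commute[of _ c])
  qed (use ab c q act_closed not_F in auto)
  moreover have "\<phi> c a \<noteq> \<phi> c b"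
    using not_F[OF l.F_one] by auto
  moreover have "r \<in> P" if r: "r \<in> carrier Q" "u \<in> M" "\<phi> u (\<phi> r a) = \<phi> u (\<phi> r b)" for r u
  proof -
    have "r \<in> I \<one>" using r M_carrier ab by (auto simp: I_def act_mult)
    then show ?thesis using I_mono[of \<one> c] c by auto
  qed
  ultimately show ?thesis using that[OF prime disjoint] c by blast
qed

lemma submonoid_one: "submonoid {\<one>} Q"
  by standard auto

lemma submonoid_powers:
  assumes "p \<in> carrier Q"
  shows "submonoid (range (\<lambda>n::nat. p [^] n)) Q"
proof
  show "\<one> \<in> range (\<lambda>n::nat. p [^] n)" by (rule range_eqI[of _ _ 0]) simp
next
  fix x y assume "x \<in> range (\<lambda>n::nat. p [^] n)" "y \<in> range (\<lambda>n::nat. p [^] n)"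
  then show "x \<otimes> y \<in> range (\<lambda>n::nat. p [^] n)"
    using assms by (auto simp: nat_pow_mult)
qed (use assms in auto)

text \<open>
  Apply \<open>separated_pair_has_key_witness\<close> to \<open>t\<close> and some \<open>qt \<noteq> t\<close>.
\<close>
lemma non_nil_has_key_witness:
  assumes noeth: "noetherian_monoid Q" and t: "t \<in> T" "t \<notin> nil_elements Q \<phi> T"
  obtains P c where "prime_monoid_ideal Q P" "c \<in> carrier Q" "key_witness Q \<phi> T P (\<phi> c t)"
proof -
  obtain q where q: "q \<in> carrier Q" "\<phi> q t \<noteq> t" using t by (auto simp: nil_iff)
  obtain P c where P: "prime_monoid_ideal Q P" "c \<in> carrier Q"
    "key_witness Q \<phi> T P (\<phi> c t) \<or> key_witness Q \<phi> T P (\<phi> c (\<phi> q t))"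
  proof (rule separated_pair_has_key_witness[OF noeth submonoid_one, of t "\<phi> q t" q \<one>])
  qed (use q t act_closed act_one in auto)
  moreover have "\<phi> c (\<phi> q t) = \<phi> (c \<otimes> q) t" using P q t by (simp add: act_mult)
  ultimately show ?thesis using that[of P] q by auto
qed

text \<open>
  Apply \<open>separated_pair_has_key_witness\<close> to two distinct elements that \<open>f\<close> identifies.
\<close>
lemma non_cancellative_has_key_witness:
  assumes noeth: "noetherian_monoid Q" and f: "f \<in> carrier Q" "\<not> acts_cancellatively \<phi> T f"
  obtains P w where "prime_monoid_ideal Q P" "key_witness Q \<phi> T P w" "f \<in> P"
proof -
  obtain a b where ab: "a \<in> T" "b \<in> T" "\<phi> f a = \<phi> f b" "a \<noteq> b"
    using f(2) by (auto simp: acts_cancellatively_def inj_on_def)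
  obtain P c where P: "prime_monoid_ideal Q P"
    "\<And>r u. r \<in> carrier Q \<Longrightarrow> u \<in> {\<one>} \<Longrightarrow> \<phi> u (\<phi> r a) = \<phi> u (\<phi> r b) \<Longrightarrow> r \<in> P"
    "key_witness Q \<phi> T P (\<phi> c a) \<or> key_witness Q \<phi> T P (\<phi> c b)"
  proof (rule separated_pair_has_key_witness[OF noeth submonoid_one ab(1,2) f(1) f(1) ab(3)])
  qed (use ab act_one in auto)
  moreover have "f \<in> P" using P(2)[of f \<one>] f ab by auto
  ultimately show ?thesis using that by blast
qed

text \<open>
  If no \<open>p\<^sup>n\<close> makes \<open>t\<close> nil, then some generator \<open>s\<close> moves all of the \<open>p\<^sup>nt\<close>: otherwise each of the
  finitely many generators fixes \<open>p\<^sup>nt\<close> for large \<open>n\<close>, and then all of \<open>Q\<close> does.  The powers of \<open>p\<close> thus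
  separate \<open>t\<close> from \<open>st\<close>, which yields a prime that avoids \<open>p\<close>.
\<close>
lemma non_nilpotent_has_key_witness:
  assumes noeth: "noetherian_monoid Q" and p: "p \<in> carrier Q" "\<not> acts_nilpotently Q \<phi> T p"
  obtains P w where "prime_monoid_ideal Q P" "key_witness Q \<phi> T P w" "p \<notin> P"
proof -
  obtain t where t: "t \<in> T" "\<And>n::nat. \<phi> (p [^] n) t \<notin> nil_elements Q \<phi> T"
    using p(2) by (auto simp: acts_nilpotently_def)
  obtain S where S: "finite S" "S \<subseteq> carrier Q" "(\<lambda>H. submonoid H Q) hull S = carrier Q"
    using noeth by (auto simp: noetherian_monoid_def)
  have "\<exists>s\<in>S. \<forall>n::nat. \<phi> (p [^] n) t \<noteq> \<phi> (p [^] n) (\<phi> s t)"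
  proof (rule ccontr)
    assume "\<not> ?thesis"
    then obtain n where n: "\<And>s. s \<in> S \<Longrightarrow> \<phi> (p [^] (n s :: nat)) t = \<phi> (p [^] n s) (\<phi> s t)"
      by metis
    \<comment> \<open>The sum is a convenient common upper bound of the exponents.\<close>
    define N where "N = sum n S"
    let ?x = "\<phi> (p [^] N) t"
    have x: "?x \<in> T" using t p by (simp add: act_closed)
    have "\<phi> s ?x = ?x" if s: "s \<in> S" for s
    proof -
      have "n s \<le> N" unfolding N_def using s S(1) by (simp add: member_le_sum)
      then obtain k where k: "N = k + n s" by (metis le_iff_add add.commute)
      have "\<phi> s ?x = \<phi> (p [^] N) (\<phi> s t)" using s S(2) p t by (intro act_commute) auto
      also have "\<dots> = \<phi> (p [^] k) (\<phi> (p [^] n s) (\<phi> s t))"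
        unfolding k using s S(2) p t
        by (simp add: nat_pow_mult[symmetric] act_mult act_closed subset_iff)
      also have "\<dots> = ?x"
        unfolding k n[OF s, symmetric] using p t by (simp add: nat_pow_mult[symmetric] act_mult)
      finally show ?thesis .
    qed
    moreover have "submonoid {q \<in> carrier Q. \<phi> q ?x = ?x} Q"
      by standard (use x act_one act_mult in auto)
    ultimately have "carrier Q \<subseteq> {q \<in> carrier Q. \<phi> q ?x = ?x}"
      unfolding S(3)[symmetric] using S(2) S(3) by (intro hull_minimal) auto
    then have "?x \<in> nil_elements Q \<phi> T" using x by (auto simp: nil_iff)
    then show False using t(2) by blast
  qed
  then obtain s where s: "s \<in> carrier Q" "\<And>n::nat. \<phi> (p [^] n) t \<noteq> \<phi> (p [^] n) (\<phi> s t)"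
    using S(2) by blast
  obtain P c where P: "prime_monoid_ideal Q P" "P \<inter> range (\<lambda>n::nat. p [^] n) = {}"
    "key_witness Q \<phi> T P (\<phi> c t) \<or> key_witness Q \<phi> T P (\<phi> c (\<phi> s t))"
  proof (rule separated_pair_has_key_witness[OF noeth submonoid_powers[OF p(1)], of t "\<phi> s t" s \<one>])
  qed (use s t act_closed act_one in auto)
  moreover have "p \<in> range (\<lambda>n::nat. p [^] n)"
    using p by (intro range_eqI[of _ _ 1]) simp
  ultimately show ?thesis using that by blast
qed

section \<open>The three characterizations\<close>

definition uniform_kernels :: "'a set \<Rightarrow> bool" where
  "uniform_kernels P \<longleftrightarrow>
     (\<forall>t \<in> T - nil_elements Q \<phi> T. \<forall>t' \<in> T - nil_elements Q \<phi> T.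
        ker_on (carrier Q - P) (\<lambda>f. \<phi> f t) = ker_on (carrier Q - P) (\<lambda>f. \<phi> f t'))"

lemma uniform_kernelsD:
  assumes "uniform_kernels P" "t \<in> T" "t \<notin> nil_elements Q \<phi> T"
    "t' \<in> T" "t' \<notin> nil_elements Q \<phi> T"
    "f \<in> carrier Q - P" "g \<in> carrier Q - P" "\<phi> f t = \<phi> g t"
  shows "\<phi> f t' = \<phi> g t'"
proof -
  have "(f, g) \<in> ker_on (carrier Q - P) (\<lambda>f. \<phi> f t)" using assms by (simp add: ker_on_def)
  then have "(f, g) \<in> ker_on (carrier Q - P) (\<lambda>f. \<phi> f t')"
    using assms unfolding uniform_kernels_def by blast
  then show ?thesis by (simp add: ker_on_def)
qed

lemma uniform_kernelsI:
  assumes "\<And>t t' f g. \<lbrakk>t \<in> T; t \<notin> nil_elements Q \<phi> T; t' \<in> T; t' \<notin> nil_elements Q \<phi> T;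
    f \<in> carrier Q - P; g \<in> carrier Q - P; \<phi> f t = \<phi> g t\<rbrakk> \<Longrightarrow> \<phi> f t' = \<phi> g t'"
  shows "uniform_kernels P"
proof -
  have "ker_on (carrier Q - P) (\<lambda>f. \<phi> f t) \<subseteq> ker_on (carrier Q - P) (\<lambda>f. \<phi> f t')"
    if "t \<in> T - nil_elements Q \<phi> T" "t' \<in> T - nil_elements Q \<phi> T" for t t'
    using assms that by (auto simp: ker_on_def)
  then show ?thesis unfolding uniform_kernels_def by blast
qed

lemma cancellative_nil_iff:
  assumes "acts_cancellatively \<phi> T f" "f \<in> carrier Q" "t \<in> T"
  shows "\<phi> f t \<in> nil_elements Q \<phi> T \<longleftrightarrow> t \<in> nil_elements Q \<phi> T"
proof
  assume nil: "\<phi> f t \<in> nil_elements Q \<phi> T"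
  then have "\<phi> f (\<phi> f t) = \<phi> f t" using assms(2) by (simp add: nil_iff)
  then have "\<phi> f t = t"
    using assms by (auto simp: acts_cancellatively_def inj_on_def act_closed)
  then show "t \<in> nil_elements Q \<phi> T" using nil by simp
qed (use assms in \<open>auto simp: nil_iff\<close>)

text \<open>
  If \<open>f\<^sup>nt\<close> is nil, then cancelling \<open>f\<close> repeatedly shows that \<open>t\<close> is nil.
\<close>
lemma not_cancellative_and_nilpotent:
  assumes "f \<in> carrier Q" "acts_cancellatively \<phi> T f" "acts_nilpotently Q \<phi> T f"
  shows "T = nil_elements Q \<phi> T"
proof -
  have "t \<in> nil_elements Q \<phi> T" if t: "t \<in> T" for t
  proof -
    obtain n :: nat where n: "\<phi> (f [^] n) t \<in> nil_elements Q \<phi> T"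
      using assms(3) t by (auto simp: acts_nilpotently_def)
    then show ?thesis
    proof (induction n)
      case 0
      then show ?case using t by (simp add: act_one)
    next
      case (Suc n)
      have "\<phi> (f [^] Suc n) t = \<phi> f (\<phi> (f [^] n) t)"
        using assms(1) t by (simp add: m_comm act_mult)
      then show ?case
        using Suc cancellative_nil_iff[OF assms(2,1), of "\<phi> (f [^] n) t"] assms(1) t
        by (simp add: act_closed)
    qed
  qed
  then show ?thesis by (auto simp: nil_elements_def)
qed

text \<open>
  The prime consists of the elements that act nilpotently.  If all elements are nil, then every
  element of \<open>Q\<close> acts as the identity, both cancellatively and nilpotently, and the
  empty prime is taken instead.  Partial cancellativity applies to \<open>ft = gt\<close> because a
  cancellative \<open>f\<close> keeps \<open>t\<close> out of the nil elements.
\<close>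
lemma mesoprimary_imp_P_primary:
  assumes meso: "mesoprimary_module Q \<phi> T"
  obtains P where "prime_monoid_ideal Q P" "P_primary_module Q \<phi> T P" "uniform_kernels P"
proof (cases "T = nil_elements Q \<phi> T")
  case True
  then have id: "\<phi> q t = t" if "q \<in> carrier Q" "t \<in> T" for q t
    using that nil_iff by blast
  have "prime_monoid_ideal Q {}"
    unfolding prime_monoid_ideal_def monoid_ideal_def by (auto intro: submonoid.intro)
  moreover have "P_primary_module Q \<phi> T {}"
    using id by (auto simp: P_primary_module_def acts_cancellatively_def inj_on_def)
  moreover have "uniform_kernels {}"
    using True by (auto simp: uniform_kernels_def)
  ultimately show ?thesis using that by blast
next
  case False
  define P where "P = {q \<in> carrier Q. acts_nilpotently Q \<phi> T q}"
  have canc: "q \<in> carrier Q - P \<longleftrightarrow> q \<in> carrier Q \<and> acts_cancellatively \<phi> T q" for q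
    using meso not_cancellative_and_nilpotent False
    by (auto simp: mesoprimary_module_def primary_module_def P_def)
  have "prime_monoid_ideal Q P"
    unfolding prime_monoid_ideal_def
  proof
    show "monoid_ideal Q P"
      unfolding monoid_ideal_def
    proof (intro conjI ballI)
      show "P \<subseteq> carrier Q" by (auto simp: P_def)
      fix q p assume q: "q \<in> carrier Q" and p: "p \<in> P"
      have "acts_nilpotently Q \<phi> T (q \<otimes> p)"
        unfolding acts_nilpotently_def
      proof
        fix t assume t: "t \<in> T"
        then obtain n :: nat where n: "\<phi> (p [^] n) t \<in> nil_elements Q \<phi> T"
          using p by (auto simp: P_def acts_nilpotently_def)
        have "\<phi> ((q \<otimes> p) [^] n) t = \<phi> (q [^] n) (\<phi> (p [^] n) t)"
          using p q t by (simp add: P_def nat_pow_distrib act_mult)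
        also have "\<dots> = \<phi> (p [^] n) t" using n q by (simp add: nil_iff)
        finally show "\<exists>n::nat. \<phi> ((q \<otimes> p) [^] n) t \<in> nil_elements Q \<phi> T"
          using n by (intro exI[of _ n]) simp
      qed
      then show "q \<otimes> p \<in> P" using p q by (auto simp: P_def)
    qed
    show "submonoid (carrier Q - P) Q"
    proof
      have "acts_cancellatively \<phi> T \<one>"
        by (auto simp: acts_cancellatively_def inj_on_def act_one)
      then show "\<one> \<in> carrier Q - P" unfolding canc by simp
    next
      fix f g assume "f \<in> carrier Q - P" "g \<in> carrier Q - P"
      then have fg: "f \<in> carrier Q" "g \<in> carrier Q" "inj_on (\<phi> f) T" "inj_on (\<phi> g) T"
        unfolding canc acts_cancellatively_def by auto
      have "inj_on (\<phi> (f \<otimes> g)) T"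
      proof (rule inj_onI)
        fix x y assume xy: "x \<in> T" "y \<in> T" "\<phi> (f \<otimes> g) x = \<phi> (f \<otimes> g) y"
        then have "\<phi> f (\<phi> g x) = \<phi> f (\<phi> g y)" using fg by (simp add: act_mult)
        then have "\<phi> g x = \<phi> g y" using fg(2,3) xy by (simp add: inj_on_eq_iff act_closed)
        then show "x = y" using fg(4) xy by (simp add: inj_on_eq_iff)
      qed
      then show "f \<otimes> g \<in> carrier Q - P"
        unfolding canc acts_cancellatively_def using fg by simp
    qed auto
  qed
  moreover have "P_primary_module Q \<phi> T P"
    using canc by (auto simp: P_primary_module_def P_def)
  moreover have "uniform_kernels P"
  proof (rule uniform_kernelsI)
    fix t t' f g
    assume *: "t \<in> T" "t \<notin> nil_elements Q \<phi> T" "t' \<in> T" "t' \<notin> nil_elements Q \<phi> T"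
      "f \<in> carrier Q - P" "g \<in> carrier Q - P" "\<phi> f t = \<phi> g t"
    then have "\<phi> f t \<notin> nil_elements Q \<phi> T" using canc cancellative_nil_iff by auto
    then show "\<phi> f t' = \<phi> g t'"
      using * meso canc unfolding mesoprimary_module_def partly_cancellative_def by blast
  qed
  ultimately show ?thesis using that by blast
qed

lemma P_primary_imp_mesoprimary:
  assumes primary: "P_primary_module Q \<phi> T P"
    and uniform: "uniform_kernels P"
  shows "mesoprimary_module Q \<phi> T"
proof -
  have "\<phi> a s = \<phi> b s"
    if t: "t \<in> T" and a: "a \<in> carrier Q" "acts_cancellatively \<phi> T a"
      and b: "b \<in> carrier Q" "acts_cancellatively \<phi> T b"
      and eq: "\<phi> a t = \<phi> b t" "\<phi> a t \<notin> nil_elements Q \<phi> T" and s: "s \<in> T" for a b t s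
  proof -
    have t_nil: "t \<notin> nil_elements Q \<phi> T" using eq(2) a t cancellative_nil_iff by auto
    then have "a \<notin> P" "b \<notin> P"
      using primary a b t not_cancellative_and_nilpotent by (auto simp: P_primary_module_def)
    then show ?thesis
      using uniform_kernelsD[OF uniform t t_nil s] a b s eq(1) nil_iff[of s] by auto
  qed
  then have "\<forall>t\<in>T. partly_cancellative Q \<phi> T t"
    unfolding partly_cancellative_def by blast
  moreover have "primary_module Q \<phi> T"
    using primary by (auto simp: primary_module_def P_primary_module_def)
  ultimately show ?thesis by (simp add: mesoprimary_module_def)
qed

lemma P_primary_key_witness_prime:
  assumes primary: "P_primary_module Q \<phi> T P" and P: "P \<subseteq> carrier Q"
    and P': "prime_monoid_ideal Q P'" and key: "key_witness Q \<phi> T P' w"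
  shows "P' = P"
proof -
  interpret l: localization Q \<phi> T P' using P' by (rule localizationI)
  show ?thesis
    using primary P l.key_witness_F_not_nilpotent[OF key] l.key_witness_P_not_cancellative[OF key]
      l.P_carrier
    unfolding P_primary_module_def by blast
qed

text \<open>
  When \<open>F\<close> acts cancellatively, \<open>T\<close> embeds into \<open>T\<^sub>P\<close>, and the stabilizer can be read off in \<open>T\<close>.
\<close>
lemma prime_congruence_cancellative_iff:
  assumes P: "prime_monoid_ideal Q P" and w: "w \<in> T"
    and canc: "\<And>f. f \<in> carrier Q - P \<Longrightarrow> acts_cancellatively \<phi> T f"
  shows "(a, b) \<in> prime_congruence Q \<phi> T P w \<longleftrightarrow>
    a \<in> P \<and> b \<in> P \<or> a \<in> carrier Q - P \<and> b \<in> carrier Q - P \<and> \<phi> a w = \<phi> b w"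
proof -
  interpret l: localization Q \<phi> T P using P by (rule localizationI)
  have "(\<exists>u\<in>l.F. \<phi> u (\<phi> a w) = \<phi> u (\<phi> b w)) \<longleftrightarrow> \<phi> a w = \<phi> b w"
    if "a \<in> l.F" "b \<in> l.F"
    using canc that w l.F_one unfolding acts_cancellatively_def inj_on_def
    by (metis act_closed l.F_carrier)
  then show ?thesis unfolding l.prime_congruence_iff[OF w] by auto
qed

text \<open>
  Any non-nil element yields a key witness, for some prime; the prime has to be \<open>P\<close>, and by
  the uniform kernels the congruence is the same at all key witnesses.
\<close>
lemma mesoprimary_imp_unique_congruence:
  assumes noeth: "noetherian_monoid Q" and meso: "mesoprimary_module Q \<phi> T"
    and not_nil: "T \<noteq> nil_elements Q \<phi> T"
  shows "\<exists>!C. C \<in> associated_prime_congruences Q \<phi> T"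
proof -
  obtain P where P: "prime_monoid_ideal Q P" "P_primary_module Q \<phi> T P" "uniform_kernels P"
    using meso by (rule mesoprimary_imp_P_primary)
  interpret l: localization Q \<phi> T P using P(1) by (rule localizationI)
  obtain t where "t \<in> T" "t \<notin> nil_elements Q \<phi> T"
    using not_nil by (auto simp: nil_elements_def)
  then obtain P0 c where c: "prime_monoid_ideal Q P0" "key_witness Q \<phi> T P0 (\<phi> c t)"
    using non_nil_has_key_witness[OF noeth] by blast
  show ?thesis
  proof (rule ex_ex1I)
    show "\<exists>C. C \<in> associated_prime_congruences Q \<phi> T"
      using c by (auto simp: associated_prime_congruences_def)
  next
    fix C D
    assume "C \<in> associated_prime_congruences Q \<phi> T" "D \<in> associated_prime_congruences Q \<phi> T"
    moreover have "P' = P" if "prime_monoid_ideal Q P'" "key_witness Q \<phi> T P' w" for P' w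
      using that P(2) l.P_carrier by (intro P_primary_key_witness_prime) auto
    ultimately obtain v w where
      C: "C = prime_congruence Q \<phi> T P v" "key_witness Q \<phi> T P v" and
      D: "D = prime_congruence Q \<phi> T P w" "key_witness Q \<phi> T P w"
      by (auto simp: associated_prime_congruences_def)
    have "\<phi> a v = \<phi> b v \<longleftrightarrow> \<phi> a w = \<phi> b w" if "a \<in> l.F" "b \<in> l.F" for a b
      using uniform_kernelsD[OF P(3)] l.key_witness_not_nil[OF C(2)]
        l.key_witness_not_nil[OF D(2)] that by metis
    moreover have "(a, b) \<in> prime_congruence Q \<phi> T P x \<longleftrightarrow> a \<in> P \<and> b \<in> P \<or>
        a \<in> l.F \<and> b \<in> l.F \<and> \<phi> a x = \<phi> b x" if "key_witness Q \<phi> T P x" for a b x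
      using l.key_witness_not_nil(1)[OF that] P(2)
      by (intro prime_congruence_cancellative_iff P(1)) (auto simp: P_primary_module_def)
    ultimately show "C = D"
      unfolding C(1) D(1) using C(2) D(2) by (simp add: set_eq_iff) blast
  qed
qed

text \<open>
  The primes found for a non-cancellative or a non-nilpotent element must all be the single prime
  \<open>P\<close> of the given congruence; this settles that \<open>T\<close> is \<open>P\<close>-primary.  The kernels
  are then compared with the congruence itself.
\<close>
lemma unique_congruence_imp_P_primary:
  assumes noeth: "noetherian_monoid Q"
    and unique: "\<exists>!C. C \<in> associated_prime_congruences Q \<phi> T"
  obtains P where "prime_monoid_ideal Q P" "P_primary_module Q \<phi> T P" "uniform_kernels P"
proof -
  obtain C where C: "C \<in> associated_prime_congruences Q \<phi> T"
    "\<And>D. D \<in> associated_prime_congruences Q \<phi> T \<Longrightarrow> D = C" using unique by blast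
  from C(1) obtain P w0 where P: "prime_monoid_ideal Q P" "key_witness Q \<phi> T P w0"
    "C = prime_congruence Q \<phi> T P w0"
    by (auto simp: associated_prime_congruences_def)
  interpret l: localization Q \<phi> T P using P(1) by (rule localizationI)
  have same: "P' = P \<and> prime_congruence Q \<phi> T P w = C"
    if "prime_monoid_ideal Q P'" "key_witness Q \<phi> T P' w" for P' w
  proof -
    have eq: "prime_congruence Q \<phi> T P' w = C"
      using that by (intro C(2)) (auto simp: associated_prime_congruences_def)
    moreover have "w \<in> T" "w0 \<in> T" using that P(2) by (auto simp: key_witness_def)
    ultimately have "P' = P"
      using prime_congruence_determines_prime that(1) P by metis
    then show ?thesis using eq by simp
  qed
  have canc: "acts_cancellatively \<phi> T f" if "f \<in> l.F" for f
    using that non_cancellative_has_key_witness[OF noeth] same by (metis Diff_iff)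
  have "acts_nilpotently Q \<phi> T p" if "p \<in> P" for p
    using that non_nilpotent_has_key_witness[OF noeth] same l.P_carrier by metis
  then have primary: "P_primary_module Q \<phi> T P"
    using canc by (simp add: P_primary_module_def)
  have key_iff: "(f, g) \<in> C \<longleftrightarrow> \<phi> f w = \<phi> g w"
    if "prime_monoid_ideal Q P'" "key_witness Q \<phi> T P' w" "f \<in> l.F" "g \<in> l.F" for P' w f g
  proof -
    have "w \<in> T" using that(2) by (simp add: key_witness_def)
    then show ?thesis
      using same[OF that(1,2)] prime_congruence_cancellative_iff[OF P(1) _ canc, of w f g] that
      by auto
  qed
  have ker: "\<phi> f t = \<phi> g t \<longleftrightarrow> (f, g) \<in> C"
    if t: "t \<in> T" "t \<notin> nil_elements Q \<phi> T" and f: "f \<in> l.F" and g: "g \<in> l.F" for t f g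
  proof
    assume eq: "\<phi> f t = \<phi> g t"
    obtain P' c where c: "prime_monoid_ideal Q P'" "c \<in> carrier Q"
      "key_witness Q \<phi> T P' (\<phi> c t)"
      using noeth t by (rule non_nil_has_key_witness)
    have "\<phi> f (\<phi> c t) = \<phi> g (\<phi> c t)"
      using eq c(2) t f g by (simp add: act_commute[of _ c])
    then show "(f, g) \<in> C" using key_iff[OF c(1,3)] f g by simp
  next
    assume fg: "(f, g) \<in> C"
    show "\<phi> f t = \<phi> g t"
    proof (rule ccontr)
      assume ne: "\<phi> f t \<noteq> \<phi> g t"
      obtain P' c where c: "prime_monoid_ideal Q P'" "c \<in> carrier Q"
        "\<phi> c (\<phi> f t) \<noteq> \<phi> c (\<phi> g t)"
        "key_witness Q \<phi> T P' (\<phi> c (\<phi> f t)) \<or> key_witness Q \<phi> T P' (\<phi> c (\<phi> g t))"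
      proof (rule separated_pair_has_key_witness[OF noeth submonoid_one, of "\<phi> f t" "\<phi> g t" g f])
        show "\<phi> g (\<phi> f t) = \<phi> f (\<phi> g t)" using t f g by (simp add: act_commute)
      qed (use t f g ne act_closed act_one in auto)
      \<comment> \<open>If \<open>f\<close> and \<open>g\<close> agree on one of \<open>cft\<close> and \<open>cgt\<close>, this identity makes \<open>f\<close> or \<open>g\<close> identify the two,
        against cancellativity.\<close>
      have swap: "\<phi> f (\<phi> c (\<phi> g t)) = \<phi> g (\<phi> c (\<phi> f t))"
        using t f g c(2) by (simp add: act_mult[symmetric] m_ac)
      have T: "\<phi> c (\<phi> f t) \<in> T" "\<phi> c (\<phi> g t) \<in> T"
        using t f g c(2) by (auto intro!: act_closed)
      from c(4) show False
      proof
        assume "key_witness Q \<phi> T P' (\<phi> c (\<phi> f t))"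
        then have "\<phi> f (\<phi> c (\<phi> f t)) = \<phi> f (\<phi> c (\<phi> g t))"
          using key_iff c(1) f g fg swap by metis
        then show False
          using canc[OF f] T c(3) by (auto simp: acts_cancellatively_def dest: inj_onD)
      next
        assume "key_witness Q \<phi> T P' (\<phi> c (\<phi> g t))"
        then have "\<phi> g (\<phi> c (\<phi> f t)) = \<phi> g (\<phi> c (\<phi> g t))"
          using key_iff c(1) f g fg swap by metis
        then show False
          using canc[OF g] T c(3) by (auto simp: acts_cancellatively_def dest: inj_onD)
      qed
    qed
  qed
  have "uniform_kernels P"
    by (rule uniform_kernelsI) (use ker in blast)
  then show ?thesis using that P(1) primary by blast
qed

end

theorem theorem3p11:
  fixes Q :: "('a, 'm) monoid_scheme"
    and \<phi> :: "'a \<Rightarrow> 't \<Rightarrow> 't"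
    and T :: "'t set"
  assumes "noetherian_monoid Q"
    and "monoid_module Q \<phi> T"
  shows "(mesoprimary_module Q \<phi> T \<longleftrightarrow>
            (\<exists>P. prime_monoid_ideal Q P \<and> P_primary_module Q \<phi> T P \<and>
               (\<forall>t \<in> T - nil_elements Q \<phi> T. \<forall>t' \<in> T - nil_elements Q \<phi> T.
                  ker_on (carrier Q - P) (\<lambda>f. \<phi> f t) = ker_on (carrier Q - P) (\<lambda>f. \<phi> f t'))))
       \<and> ((\<exists>!C. C \<in> associated_prime_congruences Q \<phi> T) \<longrightarrow> mesoprimary_module Q \<phi> T)
       \<and> (T \<noteq> nil_elements Q \<phi> T \<longrightarrow> mesoprimary_module Q \<phi> T \<longrightarrow>
            (\<exists>!C. C \<in> associated_prime_congruences Q \<phi> T))"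
proof -
  interpret monoid_module Q \<phi> T by fact
  have iff: "mesoprimary_module Q \<phi> T \<longleftrightarrow>
      (\<exists>P. prime_monoid_ideal Q P \<and> P_primary_module Q \<phi> T P \<and> uniform_kernels P)"
    using mesoprimary_imp_P_primary P_primary_imp_mesoprimary by metis
  have unique: "mesoprimary_module Q \<phi> T"
    if "\<exists>!C. C \<in> associated_prime_congruences Q \<phi> T"
    using unique_congruence_imp_P_primary[OF assms(1) that] P_primary_imp_mesoprimary by blast
  from iff[unfolded uniform_kernels_def] show ?thesis
  proof (rule conjI, intro conjI impI)
    assume "\<exists>!C. C \<in> associated_prime_congruences Q \<phi> T"
    then show "mesoprimary_module Q \<phi> T" by (rule unique)
  next
    assume "T \<noteq> nil_elements Q \<phi> T" "mesoprimary_module Q \<phi> T"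
    then show "\<exists>!C. C \<in> associated_prime_congruences Q \<phi> T"
      by (intro mesoprimary_imp_unique_congruence[OF assms(1)])
  qed
qed

end
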